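(* Let $Q$ be a measure on $\mathbb{R}$, let $\Gamma^{\text{can}}=\{\beta\in\mathbb{R}: Z(\beta)<\infty\}$ be the canonical parameter space of the one-dimensional exponential family generated by $Q$, and let $\{P_\beta:\beta\in\Gamma^{\text{can}}_0\}$, with $\Gamma^{\text{can}}_0=\{\beta\in\Gamma^{\text{can}}:\beta\ge b\}$ and $\beta_{\inf}<b<\beta_{\sup}$, be a left-truncated version of this family. Then the following statements are all equivalent: 1. The Shtarkov integral $S$ of the left-truncated family is finite. 2. The minimax individual-sequence regret of the left-truncated family is finite. 3. The minimax expected redundancy of the left-truncated family is finite. 4. The left-truncated family has a dominating distribution in terms of information divergence, i.e. there is a probability distribution $Q_{\text{dom}}$ on $\mathbb{R}$ with $\sup_{\beta\in\Gamma^{\text{can}}_0}D(P_\beta\Vert Q_{\text{dom}})<\infty$. 5. There is an element $P_{\beta'}$ with $\beta'\in\Gamma^{\text{can}}_0$ that dominates the family in terms of information divergence, i.e. $\sup_{\beta\in\Gamma^{\text{can}}_0}D(P_\beta\Vert P_{\beta'})<\infty$. 6. The information channel $\beta\mapsto P_\beta$, $\beta\in\Gamma^{\text{can}}_0$, has finite capacity. 7. There exists $\beta_0\in\Gamma^{\text{can}}_0$ such that $$\lim_{\beta\uparrow\beta_{\sup}}D(\beta_0\Vert\beta)<\infty\quad\text{or}\quad\lim_{\beta\uparrow\beta_{\sup}}D(\beta\Vert\beta_0)<\infty .$$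
   Context: Exponential family. $Q$ is a nonzero $\sigma$-finite measure on $\mathbb{R}$, $Z(\beta)=\int e^{\beta x}\,dQ(x)$ is the partition function, $\Gamma^{\text{can}}=\{\beta: Z(\beta)<\infty\}$ (an interval), $\beta_{\sup}=\sup\Gamma^{\text{can}}\in(-\infty,\infty]$ and $\beta_{\inf}=\inf\Gamma^{\text{can}}\in[-\infty,\infty)$. For $\beta\in\Gamma^{\text{can}}$, $P_\beta$ is the probability measure with $\frac{dP_\beta}{dQ}(x)=\frac{1}{Z(\beta)}e^{\beta x}$. Left-truncated family. A point $b$ with $\beta_{\inf}<b<\beta_{\sup}$ is fixed and the parameter set is restricted to $\Gamma^{\text{can}}_0=\{\beta\in\Gamma^{\text{can}}:\beta\ge b\}$. It contains $\beta_{\sup}$ if and only if $\beta_{\sup}<\infty$ and $Z(\beta_{\sup})<\infty$. Divergence. $D(P\Vert R)=\int\log\frac{dP}{dR}\,dP\in[0,\infty]$ is the information (Kullback–Leibler) divergence, equal to $\infty$ if $P\not\ll R$. We write $D(\beta\Vert\beta')=D(P_\beta\Vert P_{\beta'})$. All quantities below are for a single observation $x\in\mathbb{R}$. Shtarkov integral: $S=\int\frac{1}{Z(\beta_x)}e^{\beta_x x}\,dQ(x)$, where $P_{\beta_x}$ is the maximum likelihood distribution for $x$ within the family. That is, the integrand is $\sup_{\beta\in\Gamma^{\text{can}}_0}\frac{e^{\beta x}}{Z(\beta)}$, which is taken as its value also when the supremum is not attained. Minimax individual-sequence regret: $\inf_{R}\ \operatorname{ess\,sup}_{x}\ \sup_{\beta\in\Gamma^{\text{can}}_0}\log\frac{(dP_\beta/dQ)(x)}{(dR/dQ)(x)}$,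 where the infimum is over probability measures $R$ absolutely continuous with respect to $Q$ and the essential supremum is with respect to $Q$ (the ratio is $+\infty$ where $dR/dQ=0$). Minimax expected redundancy: $\inf_R\sup_{\beta\in\Gamma^{\text{can}}_0}D(P_\beta\Vert R)$, with the infimum over all probability measures $R$ on $\mathbb{R}$. Capacity of the channel $\beta\mapsto P_\beta$: the supremum over finitely supported probability distributions $w$ on $\Gamma^{\text{can}}_0$ of the mutual information $\sum_\beta w(\beta)D\big(P_\beta\,\Vert\,\sum_{\beta'}w(\beta')P_{\beta'}\big)$. *)

theory Defs
  imports "HOL-Probability.Probability"
begin

definition partition_fun :: "real measure \<Rightarrow> real \<Rightarrow> ennreal" where
  "partition_fun Q \<beta> = (\<integral>\<^sup>+ x. ennreal (exp (\<beta> * x)) \<partial>Q)"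

definition can_params :: "real measure \<Rightarrow> real set" where
  "can_params Q = {\<beta>. partition_fun Q \<beta> < \<infinity>}"

definition beta_sup :: "real measure \<Rightarrow> ereal" where
  "beta_sup Q = (SUP \<beta>\<in>can_params Q. ereal \<beta>)"

definition beta_inf :: "real measure \<Rightarrow> ereal" where
  "beta_inf Q = (INF \<beta>\<in>can_params Q. ereal \<beta>)"

definition left_trunc_params :: "real measure \<Rightarrow> real \<Rightarrow> real set" where
  "left_trunc_params Q b = {\<beta> \<in> can_params Q. b \<le> \<beta>}"

(* The density of the member with parameter beta with respect to Q, as an everywhere-defined
   function: the suprema over beta below are uncountable, so they need this version of the
   Radon-Nikodym derivative rather than an arbitrary one chosen separately for each beta.
   For beta outside can_params Q it is 0, because division by infinity gives 0 in ennreal. *)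
definition exp_density :: "real measure \<Rightarrow> real \<Rightarrow> real \<Rightarrow> ennreal" where
  "exp_density Q \<beta> x = ennreal (exp (\<beta> * x)) / partition_fun Q \<beta>"

definition exp_family :: "real measure \<Rightarrow> real \<Rightarrow> real measure" where
  "exp_family Q \<beta> = density Q (exp_density Q \<beta>)"

definition prob_measures :: "real measure set" where
  "prob_measures = {R. prob_space R \<and> sets R = sets borel}"

(* KL_divergence is a Bochner integral and so returns 0 when the integrand is not integrable.
   For probability measures with P << R the negative part of ln (dP/dR) is always P-integrable
   (as t * ln t >= - exp (- 1)), so non-integrability means precisely that the integral is
   infinity.  The reference measure is the first argument of KL_divergence. *)
definition info_div :: "real measure \<Rightarrow> real measure \<Rightarrow> ereal" where
  "info_div P R =
    (if absolutely_continuous R P \<and> integrable P (entropy_density (exp 1) R P)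
     then ereal (KL_divergence (exp 1) R P) else \<infinity>)"

definition fam_div :: "real measure \<Rightarrow> real \<Rightarrow> real \<Rightarrow> ereal" where
  "fam_div Q \<beta> \<beta>' = info_div (exp_family Q \<beta>) (exp_family Q \<beta>')"

definition shtarkov :: "real measure \<Rightarrow> real \<Rightarrow> ennreal" where
  "shtarkov Q b = (\<integral>\<^sup>+ x. (SUP \<beta>\<in>left_trunc_params Q b. exp_density Q \<beta> x) \<partial>Q)"

definition ext_ln :: "ennreal \<Rightarrow> ereal" where
  "ext_ln t = (if t = 0 then - \<infinity> else if t = \<infinity> then \<infinity> else ereal (ln (enn2real t)))"

(* exp_density is positive on the parameter set, so where dR/dQ = 0 the ennreal quotient
   is infinity. *)
definition minimax_regret :: "real measure \<Rightarrow> real \<Rightarrow> ereal" where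
  "minimax_regret Q b =
    (INF R\<in>{R \<in> prob_measures. absolutely_continuous Q R}.
      esssup Q (\<lambda>x. SUP \<beta>\<in>left_trunc_params Q b.
        ext_ln (exp_density Q \<beta> x / RN_deriv Q R x)))"

definition minimax_redundancy :: "real measure \<Rightarrow> real \<Rightarrow> ereal" where
  "minimax_redundancy Q b =
    (INF R\<in>prob_measures. SUP \<beta>\<in>left_trunc_params Q b. info_div (exp_family Q \<beta>) R)"

(* For a finitely supported w, the Giry bind is the mixture of the P beta with weights w beta. *)
definition mutual_info :: "real measure \<Rightarrow> real pmf \<Rightarrow> ereal" where
  "mutual_info Q w =
    (\<Sum>\<beta>\<in>set_pmf w. ereal (pmf w \<beta>) *
      info_div (exp_family Q \<beta>) (measure_pmf w \<bind> exp_family Q))"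

definition capacity :: "real measure \<Rightarrow> real \<Rightarrow> ereal" where
  "capacity Q b =
    (SUP w\<in>{w. finite (set_pmf w) \<and> set_pmf w \<subseteq> left_trunc_params Q b}. mutual_info Q w)"

definition up_to :: "ereal \<Rightarrow> real filter" where
  "up_to s = (if s = \<infinity> then at_top else at_left (real_of_ereal s))"

definition finite_limit :: "(real \<Rightarrow> ereal) \<Rightarrow> real filter \<Rightarrow> bool" where
  "finite_limit f F \<longleftrightarrow> (\<exists>L. (f \<longlongrightarrow> L) F \<and> L < \<infinity>)"

end

theory Submission
  imports Defs "HOL-Real_Asymp.Real_Asymp"
begin

text \<open>
  Every statement is equivalent to the following condition: either $\beta_{\sup}$ is finite and
  $Z(\beta_{\sup}) < \infty$, or $\beta_{\sup} = \infty$ and the support of $Q$ has a largest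
  point $M$ with $Q\{M\} > 0$. Under this condition the densities have an integrable envelope,
  and the divergences to $P_{\beta_{\sup}}$ (respectively to $P_b$) are bounded. Otherwise the mass
  of $P_\beta$ leaves every half line below the upper end of the support as
  $\beta \uparrow \beta_{\sup}$, while no single $P_\beta$ charges the end itself. Hence there are
  parameters $\beta_i$ and disjoint intervals $E_i$ with $P_{\beta_i}(E_i) > 1/2$, and the inequality
  $D(P \Vert R) \ge P(E) \ln c - c R(E)$ with $c = n$, averaged over $i < n$, shows
  $\frac{1}{n} \sum_{i<n} D(P_{\beta_i} \Vert R) \ge \frac{1}{2} \ln n - 1$ for every probability
  measure $R$. With $R$ arbitrary this refutes domination, and with $R$ the uniform mixture it
  makes the capacity infinite.
\<close>

text \<open>A member at a finite upper end of \<Gamma> need not have a mean, so the closed formula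
  for the divergence is used only when its first argument lies below the end. There, nonnegativity
  of the divergence is the tangent inequality for \<open>log_Z\<close>, and all convexity and
  monotonicity come from it without differentiating Z. A dominating R is arbitrary and need not have
  a density with respect to Q, so the lower bounds must use probabilities of events alone.
  Disjointness dictates c = n: the penalties c R(E_i) average to the sum of the R(E_i), which is at
  most 1, while ln c grows. The limits in the last condition are refuted without a sequence: for
  \<beta> near the upper end, the two measures compared are almost carried by complementary half
  lines, and the event inequality on one half line or the other makes each direction of the
  divergence exceed any bound.\<close>

section \<open>Information divergence\<close>

text \<open>The product f (1/f) is 1 where f is positive and finite and 0 elsewhere. R may charge {f
  = 0}, so equality cannot be expected.\<close>

lemma nn_integral_inverse_density_le:
  assumes [measurable]: "f \<in> borel_measurable R" "E \<in> sets R"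
  shows "(\<integral>\<^sup>+x. 1 / f x * indicator E x \<partial>density R f) \<le> emeasure R E"
proof -
  have le: "t * (1 / t) \<le> 1" for t :: ennreal
    by (cases "t = 0 \<or> t = top") (auto simp: ennreal_times_divide less_top)
  have "(\<integral>\<^sup>+x. 1 / f x * indicator E x \<partial>density R f) = (\<integral>\<^sup>+x. f x * (1 / f x) * indicator E x \<partial>R)"
    by (subst nn_integral_density) (auto intro!: nn_integral_cong simp: ac_simps)
  also have "\<dots> \<le> (\<integral>\<^sup>+x. 1 * indicator E x \<partial>R)"
    by (intro nn_integral_mono mult_right_mono le) auto
  finally show ?thesis by simp
qed

lemma AE_density_pos_finite:
  assumes "prob_space (density R f)" and f[measurable]: "f \<in> borel_measurable R"
  shows "AE x in density R f. 0 < f x \<and> f x < \<infinity>"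
proof -
  interpret prob_space "density R f" by fact
  have "(\<integral>\<^sup>+x. f x \<partial>R) = 1"
    using emeasure_space_1 by (simp add: emeasure_density cong: nn_integral_cong)
  then have "AE x in R. f x \<noteq> \<infinity>"
    by (intro nn_integral_noteq_infinite) auto
  then show ?thesis
    by (subst AE_density) (auto elim!: eventually_mono simp: less_top)
qed

text \<open>A real form of the preceding bound. It controls the negative part of the log density and
  turns the terms c/t of elementary logarithm bounds into probabilities under R.\<close>

lemma inverse_density_event:
  assumes P: "prob_space (density R f)" and R: "prob_space R"
    and f[measurable]: "f \<in> borel_measurable R" and E[measurable]: "E \<in> sets R"
  shows "integrable (density R f) (\<lambda>x. enn2real (1 / f x) * indicator E x)"
    and "(\<integral>x. enn2real (1 / f x) * indicator E x \<partial>density R f) \<le> measure R E"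
proof -
  interpret P: prob_space "density R f" by fact
  interpret R: prob_space R by fact
  have eq: "AE x in density R f. ennreal (enn2real (1 / f x) * indicator E x) = 1 / f x * indicator E x"
    using AE_density_pos_finite[OF P f]
  proof eventually_elim
    case (elim x)
    then have "1 / f x \<noteq> top" by (auto simp: ennreal_divide_eq_top_iff)
    then show ?case by (auto simp: indicator_def less_top)
  qed
  have le: "(\<integral>\<^sup>+x. ennreal (enn2real (1 / f x) * indicator E x) \<partial>density R f) \<le> measure R E"
    using nn_integral_inverse_density_le[of f R E] nn_integral_cong_AE[OF eq]
    by (simp add: R.emeasure_eq_measure)
  show int: "integrable (density R f) (\<lambda>x. enn2real (1 / f x) * indicator E x)"
    by (rule integrableI_nonneg) (use le in \<open>auto simp: top_unique less_top[symmetric]\<close>)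
  have "ennreal (\<integral>x. enn2real (1 / f x) * indicator E x \<partial>density R f) \<le> measure R E"
    using le by (subst nn_integral_eq_integral[symmetric, OF int]) auto
  then show "(\<integral>x. enn2real (1 / f x) * indicator E x \<partial>density R f) \<le> measure R E"
    by simp
qed

text \<open>The divergence is defined through an unspecified version of the Radon-Nikodym
  derivative; uniqueness lets an explicit density f replace it.\<close>

lemma entropy_density_density:
  assumes P: "prob_space (density R f)" and R: "prob_space R"
    and f[measurable]: "f \<in> borel_measurable R"
  shows "AE x in density R f. entropy_density (exp 1) R (density R f) x = ln (enn2real (f x))"
proof -
  interpret R: prob_space R by fact
  have "AE x in R. f x = RN_deriv R (density R f) x"
    by (rule R.RN_deriv_unique) auto
  then show ?thesis
    by (subst AE_density) (auto elim!: eventually_mono simp: entropy_density_def log_def)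
qed

text \<open>An upper bound also has to show that the entropy density is integrable, since
  \<open>info_div\<close> is infinite otherwise. Its positive part is controlled by g, its negative
  part by ln (1/t) \<le> 1/t - 1 and the integrability of 1/f.\<close>

lemma info_div_density_le:
  assumes P: "prob_space (density R f)" and R: "prob_space R"
    and f[measurable]: "f \<in> borel_measurable R"
    and g: "integrable (density R f) g" "AE x in density R f. f x \<le> ennreal (exp (g x))"
  shows "info_div (density R f) R \<le> ereal (\<integral>x. g x \<partial>density R f)"
proof -
  let ?P = "density R f" and ?e = "entropy_density (exp 1) R (density R f)"
  note pos = AE_density_pos_finite[OF P f]
  have up: "AE x in ?P. ?e x \<le> g x"
    using pos g(2) entropy_density_density[OF P R f]
  proof eventually_elim
    case (elim x)
    then have "0 < enn2real (f x)" "enn2real (f x) \<le> exp (g x)"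
      by (auto simp: enn2real_positive_iff intro: enn2real_leI)
    then show "?e x \<le> g x"
      using elim ln_le_cancel_iff[of "enn2real (f x)" "exp (g x)"] by simp
  qed
  have lo: "AE x in ?P. - enn2real (1 / f x) \<le> ?e x"
    using pos entropy_density_density[OF P R f]
  proof eventually_elim
    case e: (elim x)
    define t where "t = enn2real (f x)"
    have t: "0 < t" "f x = ennreal t"
      using e by (auto simp: enn2real_positive_iff t_def)
    have "ln (1 / t) \<le> 1 / t - 1" using t by (intro ln_le_minus_one) auto
    moreover have "enn2real (1 / f x) = 1 / t" using t divide_ennreal[of 1 t] by simp
    ultimately show "- enn2real (1 / f x) \<le> ?e x"
      using t(1) by (simp add: e t_def[symmetric] ln_div)
  qed
  have inv: "integrable ?P (\<lambda>x. enn2real (1 / f x))"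
    using inverse_density_event(1)[OF P R, of "space R"]
    by (rule Bochner_Integration.integrable_cong[THEN iffD1, rotated 2]) auto
  have int: "integrable ?P ?e"
  proof (rule Bochner_Integration.integrable_bound)
    show "integrable ?P (\<lambda>x. \<bar>g x\<bar> + enn2real (1 / f x))"
      using g(1) inv by auto
    show "?e \<in> borel_measurable ?P"
      by (simp add: entropy_density_def)
    show "AE x in ?P. norm (?e x) \<le> norm (\<bar>g x\<bar> + enn2real (1 / f x))"
      using up lo by eventually_elim (smt (verit) enn2real_nonneg real_norm_def)
  qed
  have "(\<integral>x. ?e x \<partial>?P) \<le> (\<integral>x. g x \<partial>?P)"
    by (intro integral_mono_AE int g up)
  then show ?thesis
    using int by (simp add: info_div_def KL_divergence_def absolutely_continuousI_density)
qed

lemma info_div_density_ge: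
  assumes P: "prob_space (density R f)" and R: "prob_space R"
    and f[measurable]: "f \<in> borel_measurable R"
    and g: "integrable (density R f) g" "AE x in density R f. ennreal (exp (g x)) \<le> f x"
  shows "ereal (\<integral>x. g x \<partial>density R f) \<le> info_div (density R f) R"
proof (cases "integrable (density R f) (entropy_density (exp 1) R (density R f))")
  case True
  let ?P = "density R f" and ?e = "entropy_density (exp 1) R (density R f)"
  have lo: "AE x in ?P. g x \<le> ?e x"
    using AE_density_pos_finite[OF P f] g(2) entropy_density_density[OF P R f]
  proof eventually_elim
    case e: (elim x)
    then have "exp (g x) \<le> enn2real (f x)"
      by (cases "f x") auto
    then show "g x \<le> ?e x"
      by (metis e(3) exp_gt_zero ln_exp ln_mono)
  qed
  have "(\<integral>x. g x \<partial>?P) \<le> (\<integral>x. ?e x \<partial>?P)"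
    by (intro integral_mono_AE True g lo)
  then show ?thesis
    using True by (simp add: info_div_def KL_divergence_def)
qed (simp add: info_div_def)

text \<open>
  Apply $\ln t \ge \ln c + 1 - c/t$ on $E$ and $\ln t \ge 1 - 1/t$ off $E$ to $t = dP/dR$.
  The case $E = \emptyset$ is nonnegativity of the divergence.
\<close>
lemma info_div_event_ge:
  assumes PP: "P \<in> prob_measures" and RR: "R \<in> prob_measures"
    and E: "E \<in> sets borel" and c: "0 < c"
  shows "ereal (measure P E * ln c - c * measure R E) \<le> info_div P R"
proof (cases "absolutely_continuous R P")
  case True
  have P: "prob_space P" "sets P = sets borel" and R: "prob_space R" "sets R = sets borel"
    using PP RR by (auto simp: prob_measures_def)
  interpret P: prob_space P by fact
  interpret R: prob_space R by fact
  define f where "f = RN_deriv R P"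
  have f_meas[measurable]: "f \<in> borel_measurable R" by (simp add: f_def)
  have Pf: "P = density R f"
    using True P R by (simp add: f_def R.density_RN_deriv)
  have sp: "space R = UNIV" "space P = UNIV" using R(2) P(2) by (auto dest: sets_eq_imp_space_eq)
  have ER [measurable]: "E \<in> sets R" "- E \<in> sets R" "E \<in> sets P" "-E \<in> sets P"
    using E R P by auto
  note pf = P(1)[unfolded Pf]
  define u where "u x = enn2real (1 / f x)" for x
  have [measurable]: "u \<in> borel_measurable R" unfolding u_def by measurable
  have I1: "integrable P (\<lambda>x. u x * indicator E x)" "(\<integral>x. u x * indicator E x \<partial>P) \<le> measure R E"
    using inverse_density_event[OF pf R(1), of E] by (auto simp: u_def Pf)
  have I2: "integrable P (\<lambda>x. u x * indicator (-E) x)" "(\<integral>x. u x * indicator (-E) x \<partial>P) \<le> measure R (-E)"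
    using inverse_density_event[OF pf R(1), of "-E"] by (auto simp: u_def Pf)
  define g where "g x = 1 + ln c * indicator E x - c * (u x * indicator E x) - u x * indicator (-E) x" for x
  have ig: "integrable P g"
    unfolding g_def using I1 I2 by (intro Bochner_Integration.integrable_diff Bochner_Integration.integrable_add) (auto simp: P.emeasure_eq_measure)
  \<comment> \<open>The multiplicative form of both logarithm bounds, used with v = c/t on E and
    with v = 1/t off E.\<close>
  have key: "v * exp (1 - v) \<le> 1" for v :: real
  proof -
    have "v \<le> exp (v - 1)" using exp_ge_add_one_self[of "v - 1"] by simp
    then show ?thesis by (simp add: exp_diff field_simps)
  qed
  have "AE x in P. ennreal (exp (g x)) \<le> f x"
    using AE_density_pos_finite[OF pf f_meas] unfolding Pf[symmetric]
  proof eventually_elim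
    case e: (elim x)
    define t where "t = enn2real (f x)"
    have t: "0 < t" "f x = ennreal t"
      using e by (auto simp: enn2real_positive_iff t_def)
    have u: "u x = 1 / t" using t divide_ennreal[of 1 t] by (simp add: u_def)
    have "exp (g x) \<le> t"
    proof (cases "x \<in> E")
      case True
      then have "exp (g x) = c * exp (1 - c / t)"
        using c by (simp add: g_def u exp_diff exp_add)
      then show ?thesis using key[of "c / t"] t by (simp add: field_simps)
    next
      case False
      then show ?thesis using key[of "1 / t"] t by (simp add: g_def u field_simps)
    qed
    then show "ennreal (exp (g x)) \<le> f x" using t by (simp add: ennreal_leI)
  qed
  then have "ereal (\<integral>x. g x \<partial>P) \<le> info_div P R"
    using info_div_density_ge[OF pf R(1) f_meas, of g] ig unfolding Pf[symmetric] by blast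
  moreover have "(\<integral>x. g x \<partial>P) = 1 + ln c * measure P E - c * (\<integral>x. u x * indicator E x \<partial>P) - (\<integral>x. u x * indicator (-E) x \<partial>P)"
    unfolding g_def using I1(1) I2(1)
    using P.prob_space by (simp add: P.emeasure_eq_measure sp)
  \<comment> \<open>The leading 1 in \<open>g\<close> pays for the loss off E, which is at most
    R(-E).\<close>
  moreover have "measure R (-E) \<le> 1" by simp
  moreover have "c * (\<integral>x. u x * indicator E x \<partial>P) \<le> c * measure R E"
    using I1(2) c by (intro mult_left_mono) auto
  ultimately have "measure P E * ln c - c * measure R E \<le> (\<integral>x. g x \<partial>P)"
    using I2(2) by (simp only: mult.commute[of "measure P E"])
  then show ?thesis
    using \<open>ereal (\<integral>x. g x \<partial>P) \<le> info_div P R\<close> by (meson ereal_less_eq(3) order_trans)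
qed (simp add: info_div_def)

lemma info_div_nonneg:
  assumes "P \<in> prob_measures" "R \<in> prob_measures" shows "0 \<le> info_div P R"
  using info_div_event_ge[OF assms, of "{}" 1] by (simp add: zero_ereal_def)

lemma info_div_eq:
  assumes P: "prob_space (density R f)" and R: "prob_space R"
    and "f \<in> borel_measurable R"
    and g: "integrable (density R f) g" "AE x in density R f. f x = ennreal (exp (g x))"
  shows "info_div (density R f) R = ereal (\<integral>x. g x \<partial>density R f)"
  using assms by (intro antisym info_div_density_le info_div_density_ge) (auto elim!: eventually_mono)

section \<open>Exponential families\<close>

locale exp_generator =
  fixes Q :: "real measure"
  assumes sets_Q [measurable_cong]: "sets Q = sets borel"
    and sigma_finite_Q: "sigma_finite_measure Q"
    and Q_nonzero: "emeasure Q UNIV \<noteq> 0"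
begin

sublocale Q: sigma_finite_measure Q by (rule sigma_finite_Q)

lemma space_Q [simp]: "space Q = UNIV"
  using sets_Q by (auto dest: sets_eq_imp_space_eq)

definition Z :: "real \<Rightarrow> real" where "Z \<beta> = enn2real (partition_fun Q \<beta>)"

definition log_Z :: "real \<Rightarrow> real" where "log_Z \<beta> = ln (Z \<beta>)"

text \<open>As a single exponential the density is positive for every \<beta>, and ratios of two
  members are exponentials of affine functions of x. It agrees with \<open>exp_density\<close> on
  \<Gamma>; outside, \<open>exp_density\<close> is 0.\<close>

definition pd :: "real \<Rightarrow> real \<Rightarrow> real" where "pd \<beta> x = exp (\<beta> * x - log_Z \<beta>)"

abbreviation "\<Gamma> \<equiv> can_params Q"

abbreviation "P \<equiv> exp_family Q"

lemma pd_measurable [measurable]: "pd \<beta> \<in> borel_measurable Q"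
  unfolding pd_def by measurable

lemma pd_pos [simp]: "0 < pd \<beta> x"
  by (simp add: pd_def)

lemma pd_nonneg [simp]: "0 \<le> pd \<beta> x"
  by (simp add: pd_def)

lemma pd_neq_0 [simp]: "pd \<beta> x \<noteq> 0"
  by (simp add: pd_def)

lemma AE_Q_imp_ex: assumes "AE x in Q. R x" shows "\<exists>x. R x"
proof (rule ccontr)
  assume "\<nexists>x. R x"
  then have "AE x in Q. False" using assms by simp
  then have "ae_filter Q = bot" by (simp only: eventually_False)
  then show False using Q_nonzero by (simp add: ae_filter_eq_bot_iff)
qed

lemma partition_fun_pos: "partition_fun Q \<beta> > 0"
proof -
  have "partition_fun Q \<beta> \<noteq> 0"
  proof
    assume "partition_fun Q \<beta> = 0"
    then have "AE x in Q. ennreal (exp (\<beta> * x)) = 0"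
      unfolding partition_fun_def by (subst (asm) nn_integral_0_iff_AE) auto
    then have "\<exists>x. ennreal (exp (\<beta> * x)) = 0" by (rule AE_Q_imp_ex)
    then show False by (simp add: ennreal_eq_0_iff)
  qed
  then show ?thesis by (simp add: zero_less_iff_neq_zero)
qed

lemma partition_fun_eq: "\<beta> \<in> \<Gamma> \<Longrightarrow> partition_fun Q \<beta> = ennreal (Z \<beta>)"
  by (simp add: can_params_def Z_def)

lemma Z_pos: "\<beta> \<in> \<Gamma> \<Longrightarrow> 0 < Z \<beta>"
  using partition_fun_pos[of \<beta>] by (simp add: partition_fun_eq)

lemma exp_log_Z: "\<beta> \<in> \<Gamma> \<Longrightarrow> exp (log_Z \<beta>) = Z \<beta>"
  by (simp add: log_Z_def Z_pos)

lemma exp_density_eq: "\<beta> \<in> \<Gamma> \<Longrightarrow> exp_density Q \<beta> x = ennreal (pd \<beta> x)"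
  by (simp add: exp_density_def partition_fun_eq Z_pos divide_ennreal pd_def exp_diff exp_log_Z)

lemma exp_density_outside: "\<beta> \<notin> \<Gamma> \<Longrightarrow> exp_density Q \<beta> x = 0"
  by (simp add: exp_density_def can_params_def less_top[symmetric])

lemma exp_density_measurable [measurable]: "exp_density Q \<beta> \<in> borel_measurable Q"
  unfolding exp_density_def by measurable

lemma exp_family_eq: assumes "\<beta> \<in> \<Gamma>" shows "P \<beta> = density Q (\<lambda>x. ennreal (pd \<beta> x))"
proof -
  have "exp_density Q \<beta> = (\<lambda>x. ennreal (pd \<beta> x))" by (rule ext) (rule exp_density_eq[OF assms])
  then show ?thesis by (simp add: exp_family_def)
qed

lemma sets_P [simp, measurable_cong]: "sets (P \<beta>) = sets borel"
  by (simp add: exp_family_def sets_Q)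

lemma space_P [simp]: "space (P \<beta>) = UNIV"
  by (simp add: exp_family_def)

lemma nn_integral_exp: "\<beta> \<in> \<Gamma> \<Longrightarrow> (\<integral>\<^sup>+x. ennreal (exp (\<beta> * x)) \<partial>Q) = ennreal (Z \<beta>)"
  using partition_fun_eq[of \<beta>] by (simp add: partition_fun_def)

lemma nn_integral_pd: assumes "\<beta> \<in> \<Gamma>" shows "(\<integral>\<^sup>+x. ennreal (pd \<beta> x) \<partial>Q) = 1"
proof -
  have "(\<integral>\<^sup>+x. ennreal (pd \<beta> x) \<partial>Q) = (\<integral>\<^sup>+x. ennreal (1 / Z \<beta>) * ennreal (exp (\<beta> * x)) \<partial>Q)"
    using assms Z_pos[OF assms] by (intro nn_integral_cong) (simp add: pd_def exp_diff exp_log_Z ennreal_mult'[symmetric])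
  also have "\<dots> = ennreal (1 / Z \<beta>) * ennreal (Z \<beta>)"
    using assms by (subst nn_integral_cmult) (auto simp: nn_integral_exp)
  also have "\<dots> = 1"
    using Z_pos[OF assms] by (simp add: ennreal_mult'[symmetric])
  finally show ?thesis .
qed

lemma prob_space_P: assumes "\<beta> \<in> \<Gamma>" shows "prob_space (P \<beta>)"
  using nn_integral_pd[OF assms]
  by (intro prob_spaceI) (simp add: exp_family_eq[OF assms] emeasure_density)

lemma P_in_prob_measures: "\<beta> \<in> \<Gamma> \<Longrightarrow> P \<beta> \<in> prob_measures"
  by (simp add: prob_measures_def prob_space_P)

lemma exp_integrable: assumes "\<beta> \<in> \<Gamma>" shows "integrable Q (\<lambda>x. exp (\<beta> * x))"
  using nn_integral_exp[OF assms] by (intro integrableI_nonneg) auto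

lemma can_paramsI: assumes "integrable Q (\<lambda>x. exp (\<beta> * x))" shows "\<beta> \<in> \<Gamma>"
  using nn_integral_eq_integral[OF assms] by (simp add: can_params_def partition_fun_def)

text \<open>The sign of x decides which end dominates. Besides the interval property of \<Gamma>,
  this yields the integrable envelope when the upper end belongs to \<Gamma>.\<close>

lemma exp_le_sum:
  fixes x :: real assumes "\<beta>1 \<le> \<beta>" "\<beta> \<le> \<beta>2"
  shows "exp (\<beta> * x) \<le> exp (\<beta>1 * x) + exp (\<beta>2 * x)"
proof (cases "0 \<le> x")
  case True
  then have "exp (\<beta> * x) \<le> exp (\<beta>2 * x)" using assms by (simp add: mult_right_mono)
  then show ?thesis by (smt (verit) exp_gt_zero)
next
  case False
  then have "exp (\<beta> * x) \<le> exp (\<beta>1 * x)" using assms by (simp add: mult_right_mono_neg)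
  then show ?thesis by (smt (verit) exp_gt_zero)
qed

lemma can_params_between:
  assumes "\<beta>1 \<in> \<Gamma>" "\<beta>2 \<in> \<Gamma>" "\<beta>1 \<le> \<beta>" "\<beta> \<le> \<beta>2" shows "\<beta> \<in> \<Gamma>"
proof (rule can_paramsI, rule Bochner_Integration.integrable_bound)
  show "integrable Q (\<lambda>x. exp (\<beta>1 * x) + exp (\<beta>2 * x))"
    using assms by (intro Bochner_Integration.integrable_add exp_integrable)
  show "AE x in Q. norm (exp (\<beta> * x)) \<le> norm (exp (\<beta>1 * x) + exp (\<beta>2 * x))"
    using exp_le_sum[OF assms(3,4)] by (intro AE_I2) (simp add: abs_of_pos add_pos_pos)
qed measurable

lemma P_density:
  assumes "\<beta> \<in> \<Gamma>" "\<beta>' \<in> \<Gamma>"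
  shows "P \<beta> = density (P \<beta>') (\<lambda>x. ennreal (exp ((\<beta> - \<beta>') * x - (log_Z \<beta> - log_Z \<beta>'))))"
proof -
  have "P \<beta> = density Q (\<lambda>x. ennreal (pd \<beta>' x) * ennreal (exp ((\<beta> - \<beta>') * x - (log_Z \<beta> - log_Z \<beta>'))))"
    using assms by (simp add: exp_family_eq ennreal_mult'[symmetric] pd_def exp_add[symmetric] algebra_simps)
  then show ?thesis
    using assms by (simp add: exp_family_eq density_density_eq)
qed

text \<open>A bound on the log ratio itself avoids first moments, which may fail to exist at an end
  of \<Gamma>.\<close>

lemma fam_div_le:
  assumes "\<beta> \<in> \<Gamma>" "\<beta>' \<in> \<Gamma>"
    and K: "AE x in Q. (\<beta> - \<beta>') * x - (log_Z \<beta> - log_Z \<beta>') \<le> K"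
  shows "fam_div Q \<beta> \<beta>' \<le> ereal K"
proof -
  interpret prob_space "P \<beta>" by (rule prob_space_P) fact
  let ?f = "\<lambda>x. ennreal (exp ((\<beta> - \<beta>') * x - (log_Z \<beta> - log_Z \<beta>')))"
  note eq = P_density[OF assms(1,2)]
  have "AE x in Q. 0 < ennreal (pd \<beta> x) \<longrightarrow> ?f x \<le> ennreal (exp K)"
    using K by eventually_elim (simp add: ennreal_leI)
  then have "AE x in P \<beta>. ?f x \<le> ennreal (exp K)"
    unfolding exp_family_eq[OF assms(1)] by (subst AE_density) auto
  then have "info_div (P \<beta>) (P \<beta>') \<le> ereal (\<integral>x. K \<partial>P \<beta>)"
    using info_div_density_le[of "P \<beta>'" ?f "\<lambda>x. K"] assms
    unfolding eq[symmetric] by (simp add: prob_space_P)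
  then show ?thesis by (simp add: fam_div_def prob_space[simplified])
qed

lemma fam_div_refl: "\<beta> \<in> \<Gamma> \<Longrightarrow> fam_div Q \<beta> \<beta> \<le> 0"
  using fam_div_le[of \<beta> \<beta> 0] by (simp add: zero_ereal_def)

lemma fam_div_nonneg: "\<beta> \<in> \<Gamma> \<Longrightarrow> \<beta>' \<in> \<Gamma> \<Longrightarrow> 0 \<le> fam_div Q \<beta> \<beta>'"
  unfolding fam_div_def by (intro info_div_nonneg P_in_prob_measures)

section \<open>Means and the closed formula for the divergence\<close>

definition mean :: "real \<Rightarrow> real" where "mean \<beta> = (\<integral>x. x \<partial>P \<beta>)"

text \<open>The log ratio is affine in x. Only the first argument needs a first moment, so \<beta>'
  may be an end of \<Gamma>.\<close>

lemma fam_div_eq: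
  assumes "\<beta> \<in> \<Gamma>" "\<beta>' \<in> \<Gamma>" and int: "integrable (P \<beta>) (\<lambda>x. x)"
  shows "fam_div Q \<beta> \<beta>' = ereal ((\<beta> - \<beta>') * mean \<beta> - (log_Z \<beta> - log_Z \<beta>'))"
proof -
  interpret prob_space "P \<beta>" by (rule prob_space_P) fact
  let ?g = "\<lambda>x. (\<beta> - \<beta>') * x - (log_Z \<beta> - log_Z \<beta>')"
  note eq = P_density[OF assms(1,2)]
  have g: "integrable (P \<beta>) ?g"
    by (intro Bochner_Integration.integrable_diff integrable_mult_right int) simp_all
  have "info_div (P \<beta>) (P \<beta>') = ereal (\<integral>x. ?g x \<partial>P \<beta>)"
  proof (rule info_div_eq[of "P \<beta>'" "\<lambda>x. ennreal (exp (?g x))" ?g, folded eq])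
    show "(\<lambda>x. ennreal (exp (?g x))) \<in> borel_measurable (P \<beta>')" by measurable
  qed (intro prob_space_P assms g AE_I2 refl)+
  also have "(\<integral>x. ?g x \<partial>P \<beta>) = (\<integral>x. (\<beta> - \<beta>') * x \<partial>P \<beta>) - (\<integral>x. log_Z \<beta> - log_Z \<beta>' \<partial>P \<beta>)"
    by (intro Bochner_Integration.integral_diff integrable_mult_right int) simp_all
  also have "\<dots> = (\<beta> - \<beta>') * mean \<beta> - (log_Z \<beta> - log_Z \<beta>')"
    using prob_space by (simp add: mean_def)
  finally show ?thesis by (simp add: fam_div_def)
qed

text \<open>With room d on both sides of \<beta>, the bound |x| d \<le> exp (|x| d) \<le> exp (- d
  x) + exp (d x) dominates the integrand by the exponentials at \<beta> - d and \<beta> + d.\<close>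

lemma integrable_mean:
  assumes "\<beta> - d \<in> \<Gamma>" "\<beta> + d \<in> \<Gamma>" "0 < d"
  shows "integrable (P \<beta>) (\<lambda>x. x)"
proof -
  have \<beta>: "\<beta> \<in> \<Gamma>" using assms by (intro can_params_between[OF assms(1,2)]) auto
  have "integrable Q (\<lambda>x. pd \<beta> x *\<^sub>R x)"
  proof (rule Bochner_Integration.integrable_bound)
    show "integrable Q (\<lambda>x. (exp ((\<beta> - d) * x) + exp ((\<beta> + d) * x)) * (exp (- log_Z \<beta>) / d))"
      using assms by (intro integrable_mult_left Bochner_Integration.integrable_add exp_integrable)
    have "\<bar>x\<bar> * exp (\<beta> * x) * d \<le> exp ((\<beta> - d) * x) + exp ((\<beta> + d) * x)" for x
    proof -
      have "\<bar>x\<bar> * d \<le> exp (\<bar>x\<bar> * d)" using exp_ge_add_one_self[of "\<bar>x\<bar> * d"] by linarith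
      also have "\<dots> \<le> exp (- (d * x)) + exp (d * x)"
        by (cases "0 \<le> x") (auto simp: mult.commute)
      finally have *: "\<bar>x\<bar> * d * exp (\<beta> * x) \<le> (exp (- (d * x)) + exp (d * x)) * exp (\<beta> * x)"
        by (intro mult_right_mono) auto
      have **: "exp ((\<beta> - d) * x) = exp (- (d * x)) * exp (\<beta> * x)" "exp ((\<beta> + d) * x) = exp (d * x) * exp (\<beta> * x)"
        by (simp_all add: exp_add[symmetric] algebra_simps)
      show ?thesis unfolding ** distrib_right[symmetric] using * by (simp only: mult.commute mult.left_commute)
    qed
    then have "\<bar>x\<bar> * exp (\<beta> * x) \<le> (exp ((\<beta> - d) * x) + exp ((\<beta> + d) * x)) / d" for x
      using assms(3) by (simp add: pos_le_divide_eq)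
    then have "\<bar>x\<bar> * exp (\<beta> * x) * exp (- log_Z \<beta>) \<le> (exp ((\<beta> - d) * x) + exp ((\<beta> + d) * x)) / d * exp (- log_Z \<beta>)" for x
      by (rule mult_right_mono) simp
    moreover have "norm (pd \<beta> x *\<^sub>R x) = \<bar>x\<bar> * exp (\<beta> * x) * exp (- log_Z \<beta>)" for x
      by (simp add: pd_def abs_mult exp_add[symmetric])
    ultimately show "AE x in Q. norm (pd \<beta> x *\<^sub>R x) \<le> norm ((exp ((\<beta> - d) * x) + exp ((\<beta> + d) * x)) * (exp (- log_Z \<beta>) / d))"
      using assms(3) by (intro AE_I2) (simp add: abs_of_pos add_pos_pos)
  qed measurable
  then show ?thesis
    using \<beta> by (simp add: exp_family_eq integrable_density)
qed

end

section \<open>Left-truncated families\<close>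

text \<open>The limit is the supremum over [b, s). The fact \<open>ev\<close> is all that is used
  about the filter, so a finite and an infinite end are treated alike.\<close>

lemma finite_limit_mono:
  fixes f :: "real \<Rightarrow> ereal"
  assumes "ereal b < s"
    and mono: "\<And>x y. b \<le> x \<Longrightarrow> x \<le> y \<Longrightarrow> ereal y < s \<Longrightarrow> f x \<le> f y"
    and K: "\<And>x. b \<le> x \<Longrightarrow> ereal x < s \<Longrightarrow> f x \<le> K" "K < \<infinity>"
  shows "finite_limit f (up_to s)"
proof -
  let ?A = "{x. b \<le> x \<and> ereal x < s}"
  have ev: "\<forall>\<^sub>F y in up_to s. x \<le> y \<and> ereal y < s" if "ereal x < s" for x
  proof (cases s)
    case (real r)
    then show ?thesis
      using that eventually_at_left_real[of x r] by (auto simp: up_to_def elim!: eventually_mono)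
  qed (use that in \<open>auto simp: up_to_def eventually_ge_at_top\<close>)
  define L where "L = (SUP x\<in>?A. f x)"
  have "(f \<longlongrightarrow> L) (up_to s)"
  proof (rule order_tendstoI)
    fix a assume "a < L"
    then obtain x where x: "b \<le> x" "ereal x < s" "a < f x" by (auto simp: L_def less_SUP_iff)
    from ev[OF x(2)] show "\<forall>\<^sub>F y in up_to s. a < f y"
    proof eventually_elim
      case (elim y)
      then show ?case using mono[of x y] x by auto
    qed
  next
    fix a assume a: "L < a"
    from ev[OF assms(1)] show "\<forall>\<^sub>F y in up_to s. f y < a"
    proof eventually_elim
      case (elim y)
      then have "f y \<le> L" unfolding L_def by (intro SUP_upper) auto
      then show ?case using a by auto
    qed
  qed
  moreover have "L \<le> K" unfolding L_def using K(1) by (auto intro: SUP_least)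
  ultimately show ?thesis using K(2) by (auto simp: finite_limit_def)
qed

locale left_truncated = exp_generator +
  fixes b :: real
  assumes beta_inf_less: "beta_inf Q < ereal b"
    and less_beta_sup: "ereal b < beta_sup Q"
begin

abbreviation "\<Gamma>\<^sub>0 \<equiv> left_trunc_params Q b"

text \<open>The strict inequality \<open>beta_inf Q < ereal b\<close> enters here: b itself becomes
  an interior point, so that means exist from b up to the end.\<close>

lemma interior:
  assumes "b \<le> \<beta>" "ereal \<beta> < beta_sup Q"
  obtains d where "0 < d" "\<beta> - d \<in> \<Gamma>" "\<beta> + d \<in> \<Gamma>"
proof -
  obtain \<beta>1 where 1: "\<beta>1 \<in> \<Gamma>" "\<beta>1 < b"
    using beta_inf_less by (auto simp: beta_inf_def INF_less_iff)
  obtain \<beta>2 where 2: "\<beta>2 \<in> \<Gamma>" "\<beta> < \<beta>2"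
    using assms(2) by (auto simp: beta_sup_def less_SUP_iff)
  define d where "d = min (\<beta> - \<beta>1) (\<beta>2 - \<beta>)"
  have d: "0 < d" "\<beta>1 \<le> \<beta> - d" "\<beta> - d \<le> \<beta>2" "\<beta>1 \<le> \<beta> + d" "\<beta> + d \<le> \<beta>2"
    using 1 2 assms by (auto simp: d_def min_def)
  show thesis
    by (rule that[OF d(1) can_params_between[OF 1(1) 2(1) d(2,3)] can_params_between[OF 1(1) 2(1) d(4,5)]])
qed

lemma interior_in_can: assumes "b \<le> \<beta>" "ereal \<beta> < beta_sup Q" shows "\<beta> \<in> \<Gamma>"
proof -
  obtain d where "0 < d" "\<beta> - d \<in> \<Gamma>" "\<beta> + d \<in> \<Gamma>"
    using interior[OF assms] .
  then show ?thesis using can_params_between[of "\<beta> - d" "\<beta> + d" \<beta>] by simp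
qed

lemma interior_in_trunc: "b \<le> \<beta> \<Longrightarrow> ereal \<beta> < beta_sup Q \<Longrightarrow> \<beta> \<in> \<Gamma>\<^sub>0"
  by (simp add: left_trunc_params_def interior_in_can)

lemma trunc_cases:
  assumes "\<beta> \<in> \<Gamma>\<^sub>0"
  shows "\<beta> \<in> \<Gamma>" "b \<le> \<beta>" "ereal \<beta> \<le> beta_sup Q"
  using assms by (auto simp: left_trunc_params_def beta_sup_def intro: SUP_upper)

lemma b_in: "b \<in> \<Gamma>" "b \<in> \<Gamma>\<^sub>0"
  using less_beta_sup by (auto intro: interior_in_can interior_in_trunc)

lemma interior_mean: assumes "b \<le> \<beta>" "ereal \<beta> < beta_sup Q" shows "integrable (P \<beta>) (\<lambda>x. x)"
proof -
  obtain d where "0 < d" "\<beta> - d \<in> \<Gamma>" "\<beta> + d \<in> \<Gamma>"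
    using interior[OF assms] .
  then show ?thesis by (intro integrable_mean)
qed

section \<open>Convexity of \<open>log_Z\<close> and monotone divergences\<close>

lemma fam_div_interior:
  assumes "b \<le> \<beta>" "ereal \<beta> < beta_sup Q" "\<beta>' \<in> \<Gamma>"
  shows "fam_div Q \<beta> \<beta>' = ereal ((\<beta> - \<beta>') * mean \<beta> - (log_Z \<beta> - log_Z \<beta>'))"
  by (rule fam_div_eq[OF interior_in_can[OF assms(1,2)] assms(3) interior_mean[OF assms(1,2)]])

text \<open>This is nonnegativity of D(\<beta> || \<beta>') rearranged: the mean is a subgradient of
  \<open>log_Z\<close>. The point \<beta>' may be the upper end.\<close>

lemma log_Z_tangent:
  assumes "b \<le> \<beta>" "ereal \<beta> < beta_sup Q" "\<beta>' \<in> \<Gamma>"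
  shows "log_Z \<beta> + (\<beta>' - \<beta>) * mean \<beta> \<le> log_Z \<beta>'"
  using fam_div_nonneg[of \<beta> \<beta>'] assms by (simp add: fam_div_interior interior_in_can algebra_simps)

text \<open>Adding the tangent inequalities at the two points cancels \<open>log_Z\<close>;
  subgradients of a convex function are monotone.\<close>

lemma mean_mono:
  assumes "b \<le> \<beta>" "\<beta> \<le> \<beta>'" "ereal \<beta>' < beta_sup Q"
  shows "mean \<beta> \<le> mean \<beta>'"
proof (cases "\<beta> = \<beta>'")
  case False
  have "ereal \<beta> \<le> ereal \<beta>'" using assms by simp
  then have *: "ereal \<beta> < beta_sup Q" using assms(3) by (rule le_less_trans)
  have "log_Z \<beta> + (\<beta>' - \<beta>) * mean \<beta> \<le> log_Z \<beta>'" "log_Z \<beta>' + (\<beta> - \<beta>') * mean \<beta>' \<le> log_Z \<beta>"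
    using assms * by (auto intro!: log_Z_tangent interior_in_can)
  then have "(\<beta>' - \<beta>) * mean \<beta> \<le> (\<beta>' - \<beta>) * mean \<beta>'"
    by (simp add: algebra_simps)
  then show ?thesis using assms False by (simp add: mult_le_cancel_left)
qed simp

text \<open>By the tangent at \<beta>, the increment is at least (\<beta>' - \<beta>) (mean \<beta>
  - mean b). The mean of \<beta>' does not occur, so \<beta>' may be the upper end.\<close>

lemma fam_div_from_b_mono:
  assumes "b \<le> \<beta>" "\<beta> \<le> \<beta>'" "ereal \<beta> < beta_sup Q" "\<beta>' \<in> \<Gamma>"
  shows "fam_div Q b \<beta> \<le> fam_div Q b \<beta>'"
proof -
  have "log_Z \<beta> + (\<beta>' - \<beta>) * mean \<beta> \<le> log_Z \<beta>'" "mean b \<le> mean \<beta>"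
    using assms by (auto intro!: log_Z_tangent mean_mono)
  moreover have "(\<beta>' - \<beta>) * mean b \<le> (\<beta>' - \<beta>) * mean \<beta>"
    using assms calculation by (intro mult_left_mono) auto
  ultimately show ?thesis
    using assms less_beta_sup by (simp add: fam_div_interior interior_in_can algebra_simps)
qed

text \<open>By the tangent at \<beta>', the increment is at least (\<beta> - b) (mean \<beta>' -
  mean \<beta>).\<close>

lemma fam_div_to_b_mono:
  assumes "b \<le> \<beta>" "\<beta> \<le> \<beta>'" "ereal \<beta>' < beta_sup Q"
  shows "fam_div Q \<beta> b \<le> fam_div Q \<beta>' b"
proof -
  have "ereal \<beta> \<le> ereal \<beta>'" using assms by simp
  then have *: "ereal \<beta> < beta_sup Q" using assms(3) by (rule le_less_trans)
  have "log_Z \<beta>' + (\<beta> - \<beta>') * mean \<beta>' \<le> log_Z \<beta>" "mean \<beta> \<le> mean \<beta>'"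
    using assms * by (auto intro!: log_Z_tangent mean_mono interior_in_can)
  moreover have "(\<beta> - b) * mean \<beta> \<le> (\<beta> - b) * mean \<beta>'"
    using assms calculation by (intro mult_left_mono) auto
  ultimately show ?thesis
    using assms * less_beta_sup by (simp add: fam_div_interior interior_in_can algebra_simps)
qed

definition top_atom :: "real \<Rightarrow> bool" where
  "top_atom M \<longleftrightarrow> emeasure Q {M} > 0 \<and> (AE x in Q. x \<le> M)"

text \<open>
  The exact finiteness condition: the family has a limit at its upper end that is again a
  probability measure, namely either $P_{\beta_{\sup}}$ or the point mass at the largest
  point of the support.
\<close>
definition closed_above :: bool where
  "closed_above \<longleftrightarrow> (beta_sup Q = \<infinity> \<and> (\<exists>M. top_atom M)) \<or> (\<exists>s\<in>\<Gamma>. beta_sup Q = ereal s)"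

text \<open>Keep only the contribution of M to the integral. Finiteness of Z also excludes an atom
  of infinite mass, so \<open>measure Q {M}\<close> is the true mass and not the default 0.\<close>

lemma log_Z_ge_atom:
  assumes "\<beta> \<in> \<Gamma>" "emeasure Q {M} > 0"
  shows "\<beta> * M + ln (measure Q {M}) \<le> log_Z \<beta>"
proof -
  have "ennreal (exp (\<beta> * M)) * emeasure Q {M} = (\<integral>\<^sup>+x. ennreal (exp (\<beta> * M)) * indicator {M} x \<partial>Q)"
    by (subst nn_integral_cmult_indicator) auto
  also have "\<dots> \<le> (\<integral>\<^sup>+x. ennreal (exp (\<beta> * x)) \<partial>Q)"
    by (intro nn_integral_mono) (auto simp: indicator_def)
  finally have le: "ennreal (exp (\<beta> * M)) * emeasure Q {M} \<le> ennreal (Z \<beta>)"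
    using assms by (simp add: nn_integral_exp)
  then have "emeasure Q {M} \<noteq> \<infinity>"
    by (auto simp: ennreal_mult_top top_unique)
  then have q: "emeasure Q {M} = ennreal (measure Q {M})"
    by (simp add: emeasure_eq_ennreal_measure)
  then have pos: "0 < measure Q {M}" using assms(2) by simp
  have "exp (\<beta> * M) * measure Q {M} \<le> Z \<beta>"
    using le Z_pos[OF assms(1)] by (simp add: q ennreal_mult'[symmetric])
  then have "ln (exp (\<beta> * M) * measure Q {M}) \<le> log_Z \<beta>"
    unfolding log_Z_def using pos by (intro ln_mono) auto
  then show ?thesis using pos by (simp add: ln_mult)
qed

text \<open>The log ratio is largest at x = M, and there the atom bound on \<open>log_Z\<close>
  cancels \<beta>. The constant is - ln P_b({M}), the divergence of the point mass at M from
  P_b.\<close>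

lemma fam_div_to_b_le_atom:
  assumes "\<beta> \<in> \<Gamma>\<^sub>0" "top_atom M"
  shows "fam_div Q \<beta> b \<le> ereal (log_Z b - b * M - ln (measure Q {M}))"
proof (rule fam_div_le)
  have AE: "AE x in Q. x \<le> M" and *: "\<beta> * M + ln (measure Q {M}) \<le> log_Z \<beta>"
    using assms log_Z_ge_atom trunc_cases(1) by (auto simp: top_atom_def)
  show "AE x in Q. (\<beta> - b) * x - (log_Z \<beta> - log_Z b) \<le> log_Z b - b * M - ln (measure Q {M})"
    using AE
  proof eventually_elim
    case (elim x)
    then have "(\<beta> - b) * x \<le> (\<beta> - b) * M" using trunc_cases(2)[OF assms(1)] by (intro mult_left_mono) auto
    then show ?case using * by (simp add: algebra_simps)
  qed
qed (use assms trunc_cases b_in in auto)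

text \<open>Moving the first argument from b towards s does not increase the divergence: the
  difference is at least (s - \<beta>) (mean \<beta> - mean b).\<close>

lemma fam_div_to_end_le:
  assumes "\<beta> \<in> \<Gamma>\<^sub>0" "s \<in> \<Gamma>" "beta_sup Q = ereal s"
  shows "fam_div Q \<beta> s \<le> fam_div Q b s"
proof (cases "\<beta> = s")
  case True
  have "fam_div Q \<beta> s \<le> 0" "0 \<le> fam_div Q b s"
    using True assms b_in by (auto intro: fam_div_refl fam_div_nonneg)
  then show ?thesis by (rule order_trans)
next
  case False
  then have \<beta>: "b \<le> \<beta>" "\<beta> \<le> s" "ereal \<beta> < beta_sup Q"
    using trunc_cases[OF assms(1)] assms(3) by auto
  have "log_Z b + (\<beta> - b) * mean b \<le> log_Z \<beta>" "mean b \<le> mean \<beta>"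
    using \<beta> less_beta_sup by (auto intro!: log_Z_tangent mean_mono interior_in_can)
  moreover have "(s - \<beta>) * mean b \<le> (s - \<beta>) * mean \<beta>"
    using \<beta> calculation by (intro mult_left_mono) auto
  ultimately show ?thesis
    using \<beta> less_beta_sup assms(2) by (simp add: fam_div_interior algebra_simps)
qed

section \<open>Sufficiency of the finiteness condition\<close>

lemma closed_above_imp_member_dominates:
  assumes closed_above
  shows "\<exists>\<beta>'\<in>\<Gamma>\<^sub>0. (SUP \<beta>\<in>\<Gamma>\<^sub>0. fam_div Q \<beta> \<beta>') < \<infinity>"
  using assms unfolding closed_above_def
proof (elim disjE conjE exE bexE)
  fix M assume "top_atom M"
  then have "(SUP \<beta>\<in>\<Gamma>\<^sub>0. fam_div Q \<beta> b) \<le> ereal (log_Z b - b * M - ln (measure Q {M}))"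
    by (intro SUP_least fam_div_to_b_le_atom)
  then show ?thesis using b_in by (intro bexI[of _ b]) (auto simp: le_less_trans)
next
  fix s assume s: "s \<in> \<Gamma>" "beta_sup Q = ereal s"
  then have "(SUP \<beta>\<in>\<Gamma>\<^sub>0. fam_div Q \<beta> s) \<le> fam_div Q b s"
    by (intro SUP_least fam_div_to_end_le)
  also have "fam_div Q b s < \<infinity>"
    using s less_beta_sup by (simp add: fam_div_interior)
  finally show ?thesis
    using s less_beta_sup by (intro bexI[of _ s]) (auto simp: left_trunc_params_def)
qed

text \<open>The two cases need different directions. With a top atom D(b || \<beta>) diverges unless
  Q is concentrated at M; with a closed upper end D(\<beta> || b) may diverge because the means can
  be unbounded.\<close>

lemma closed_above_imp_finite_limit:
  assumes closed_above
  shows "finite_limit (\<lambda>\<beta>. fam_div Q b \<beta>) (up_to (beta_sup Q)) \<or>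
    finite_limit (\<lambda>\<beta>. fam_div Q \<beta> b) (up_to (beta_sup Q))"
  using assms unfolding closed_above_def
proof (elim disjE conjE exE bexE)
  fix M assume "top_atom M"
  then have "finite_limit (\<lambda>\<beta>. fam_div Q \<beta> b) (up_to (beta_sup Q))"
    by (intro finite_limit_mono[OF less_beta_sup, where K = "ereal (log_Z b - b * M - ln (measure Q {M}))"])
      (auto intro!: fam_div_to_b_mono fam_div_to_b_le_atom interior_in_trunc)
  then show ?thesis ..
next
  fix s assume s: "s \<in> \<Gamma>" "beta_sup Q = ereal s"
  have "finite_limit (\<lambda>\<beta>. fam_div Q b \<beta>) (up_to (beta_sup Q))"
  proof (rule finite_limit_mono[OF less_beta_sup])
    show "fam_div Q b x \<le> fam_div Q b y" if "b \<le> x" "x \<le> y" "ereal y < beta_sup Q" for x y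
      using that by (intro fam_div_from_b_mono interior_in_can) (auto intro: le_less_trans[of "ereal x" "ereal y"])
    show "fam_div Q b x \<le> fam_div Q b s" if "b \<le> x" "ereal x < beta_sup Q" for x
      using that s by (intro fam_div_from_b_mono) auto
    show "fam_div Q b s < \<infinity>"
      using s less_beta_sup by (simp add: fam_div_interior)
  qed
  then show ?thesis ..
qed

lemma closed_above_imp_shtarkov_finite:
  assumes closed_above
  shows "shtarkov Q b < \<infinity>"
  using assms unfolding closed_above_def
proof (elim disjE conjE exE bexE)
  fix M assume M: "top_atom M"
  let ?C = "exp (- b * M - ln (measure Q {M}))"
  have "AE x in Q. (SUP \<beta>\<in>\<Gamma>\<^sub>0. exp_density Q \<beta> x) \<le> ennreal ?C * ennreal (exp (b * x))"
    using conjunct2[OF M[unfolded top_atom_def]]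
  proof eventually_elim
    case (elim x)
    show ?case
    proof (rule SUP_least)
      fix \<beta> assume \<beta>: "\<beta> \<in> \<Gamma>\<^sub>0"
      have "(\<beta> - b) * x \<le> (\<beta> - b) * M"
        using elim trunc_cases(2)[OF \<beta>] by (intro mult_left_mono) auto
      moreover have "\<beta> * M + ln (measure Q {M}) \<le> log_Z \<beta>"
        using M log_Z_ge_atom trunc_cases(1)[OF \<beta>] by (auto simp: top_atom_def)
      ultimately have "\<beta> * x - log_Z \<beta> \<le> (- b * M - ln (measure Q {M})) + b * x"
        by (simp add: algebra_simps)
      then show "exp_density Q \<beta> x \<le> ennreal ?C * ennreal (exp (b * x))"
        using trunc_cases(1)[OF \<beta>]
        by (simp only: exp_density_eq pd_def ennreal_mult'[symmetric] exp_ge_zero exp_add[symmetric])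
          (simp add: ennreal_leI)
    qed
  qed
  then have "shtarkov Q b \<le> (\<integral>\<^sup>+x. ennreal ?C * ennreal (exp (b * x)) \<partial>Q)"
    unfolding shtarkov_def by (rule nn_integral_mono_AE)
  also have "\<dots> = ennreal ?C * ennreal (Z b)"
    by (subst nn_integral_cmult) (auto simp: nn_integral_exp b_in)
  also have "\<dots> < \<infinity>" by (simp add: ennreal_mult'[symmetric])
  finally show ?thesis .
next
  fix s assume s: "s \<in> \<Gamma>" "beta_sup Q = ereal s"
  \<comment> \<open>The tangent at b bounds \<open>log_Z\<close> from below uniformly on [b, s]; the
    absolute value covers both signs of the mean.\<close>
  let ?L = "log_Z b - (s - b) * \<bar>mean b\<bar>"
  have bd: "exp_density Q \<beta> x \<le> ennreal (exp (- ?L)) * (ennreal (exp (b * x)) + ennreal (exp (s * x)))"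
    if \<beta>: "\<beta> \<in> \<Gamma>\<^sub>0" for \<beta> x
  proof -
    have \<beta>': "b \<le> \<beta>" "\<beta> \<le> s" "\<beta> \<in> \<Gamma>" using trunc_cases[OF \<beta>] s by auto
    have "- ((s - b) * \<bar>mean b\<bar>) \<le> - ((\<beta> - b) * \<bar>mean b\<bar>)"
      using \<beta>' by (simp add: mult_right_mono)
    also have "\<dots> \<le> (\<beta> - b) * mean b"
      using \<beta>' mult_left_mono[of "- \<bar>mean b\<bar>" "mean b" "\<beta> - b"] by simp
    finally have "?L \<le> log_Z \<beta>"
      using log_Z_tangent[of b \<beta>] less_beta_sup \<beta>' by simp
    then have "pd \<beta> x \<le> exp (\<beta> * x - ?L)" by (simp add: pd_def)
    also have "\<dots> = exp (- ?L) * exp (\<beta> * x)" by (simp add: exp_add[symmetric])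
    also have "\<dots> \<le> exp (- ?L) * (exp (b * x) + exp (s * x))"
      using \<beta>' by (intro mult_left_mono exp_le_sum) auto
    finally show ?thesis
      using \<beta>'(3) by (simp add: exp_density_eq ennreal_mult'[symmetric] ennreal_plus[symmetric] ennreal_leI del: ennreal_plus)
  qed
  have "shtarkov Q b \<le> (\<integral>\<^sup>+x. ennreal (exp (- ?L)) * (ennreal (exp (b * x)) + ennreal (exp (s * x))) \<partial>Q)"
    unfolding shtarkov_def by (intro nn_integral_mono SUP_least bd)
  also have "\<dots> = ennreal (exp (- ?L)) * (ennreal (Z b) + ennreal (Z s))"
    using s b_in by (subst nn_integral_cmult) (auto simp: nn_integral_exp nn_integral_add)
  also have "\<dots> < \<infinity>" by (simp add: ennreal_mult_less_top)
  finally show ?thesis .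
qed

end

section \<open>Regret, redundancy and capacity\<close>

text \<open>The inverse of \<open>ext_ln\<close>. It moves comparisons of logarithms to comparisons
  in \<open>ennreal\<close>, where suprema and quotients are well behaved.\<close>

definition ext_exp :: "ereal \<Rightarrow> ennreal" where
  "ext_exp y = (if y = - \<infinity> then 0 else if y = \<infinity> then \<infinity> else ennreal (exp (real_of_ereal y)))"

lemma less_ext_ln_iff: "y < ext_ln t \<longleftrightarrow> ext_exp y < t"
proof (cases t)
  case (real r)
  show ?thesis
  proof (cases "r = 0")
    case False
    then have r: "0 < r" using real by simp
    have "a < ln r \<longleftrightarrow> exp a < r" for a
      using r by (metis exp_less_cancel_iff exp_ln)
    then show ?thesis
      using r real by (cases y) (auto simp: ext_ln_def ext_exp_def ennreal_less_iff)
  qed (use real in \<open>auto simp: ext_ln_def ext_exp_def\<close>)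
next
  case top
  then show ?thesis by (cases y) (auto simp: ext_ln_def ext_exp_def)
qed

lemma ext_ln_le_iff: "ext_ln t \<le> y \<longleftrightarrow> t \<le> ext_exp y"
  using less_ext_ln_iff[of y t] by (simp add: not_less[symmetric])

context left_truncated
begin

section \<open>The maximum likelihood envelope\<close>

definition env :: "real \<Rightarrow> ennreal" where
  "env x = (SUP \<beta>\<in>\<Gamma>\<^sub>0. exp_density Q \<beta> x)"

lemma shtarkov_eq: "shtarkov Q b = (\<integral>\<^sup>+x. env x \<partial>Q)"
  by (simp add: shtarkov_def env_def)

text \<open>The supremum is uncountable, but it is lower semicontinuous, hence measurable.\<close>
lemma env_measurable [measurable]: "env \<in> borel_measurable Q"
proof -
  have "env \<in> borel_measurable borel"
  proof (rule borel_measurableI_greater)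
    fix y
    have "{x \<in> space borel. y < env x} = (\<Union>\<beta>\<in>\<Gamma>\<^sub>0. {x. y < ennreal (pd \<beta> x)})"
      by (auto simp: env_def less_SUP_iff exp_density_eq trunc_cases(1))
    moreover have "open {x. y < ennreal (pd \<beta> x)}" for \<beta>
      unfolding pd_def by (intro open_Collect_less continuous_intros continuous_on_ennreal)
    ultimately show "{x \<in> space borel. y < env x} \<in> sets borel"
      by (simp add: borel_open open_UN)
  qed
  then show ?thesis by simp
qed

lemma pd_le_env: "\<beta> \<in> \<Gamma>\<^sub>0 \<Longrightarrow> ennreal (pd \<beta> x) \<le> env x"
  unfolding env_def by (rule SUP_upper2[of \<beta>]) (simp_all add: exp_density_eq trunc_cases(1))

lemma env_pos: "0 < env x"
  using pd_le_env[OF b_in(2), of x] by (rule less_le_trans[rotated]) simp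

lemma shtarkov_ge_1: "1 \<le> shtarkov Q b"
  unfolding shtarkov_eq nn_integral_pd[OF b_in(1), symmetric]
  by (intro nn_integral_mono pd_le_env b_in)

text \<open>The normalized maximum likelihood distribution, with density env / S, has regret at most
  ln S at almost every point.\<close>

lemma shtarkov_finite_imp_regret_finite:
  assumes "shtarkov Q b < \<infinity>"
  shows "minimax_regret Q b < \<infinity>"
proof -
  define S where "S = shtarkov Q b"
  have S: "1 \<le> S" "S < top" "S \<noteq> 0" using assms shtarkov_ge_1 by (auto simp: S_def)
  define R where "R = density Q (\<lambda>x. env x / S)"
  have "emeasure R (space R) = (\<integral>\<^sup>+x. env x / S \<partial>Q)"
    by (simp add: R_def emeasure_density)
  also have "\<dots> = S / S" by (simp add: nn_integral_divide shtarkov_eq[symmetric] S_def)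
  finally have "prob_space R" using S by (intro prob_spaceI) (simp add: R_def)
  then have R: "R \<in> {R \<in> prob_measures. absolutely_continuous Q R}"
    by (simp add: prob_measures_def R_def sets_Q absolutely_continuousI_density)
  have RN: "AE x in Q. env x / S = RN_deriv Q R x"
    by (rule Q.RN_deriv_unique) (simp_all add: R_def)
  let ?r = "RN_deriv Q R"
  let ?F = "\<lambda>x. SUP \<beta>\<in>\<Gamma>\<^sub>0. ext_ln (exp_density Q \<beta> x / ?r x)"
  \<comment> \<open>Strict superlevel sets carry the uncountable supremum past the logarithm and the
    division onto \<open>env\<close>, whose measurability is known.\<close>
  have F: "?F \<in> borel_measurable Q"
  proof (rule borel_measurableI_greater)
    fix y
    have "{x \<in> space Q. y < ?F x} = {x \<in> space Q. ext_exp y < env x / ?r x}"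
      by (simp add: less_SUP_iff less_ext_ln_iff env_def SUP_divide_ennreal)
    then show "{x \<in> space Q. y < ?F x} \<in> sets Q" by simp
  qed
  define y where "y = ereal (ln (enn2real S))"
  have y: "ext_exp y = S"
    using S by (cases S) (auto simp: y_def ext_exp_def)
  have "AE x in Q. ?F x \<le> y"
    using RN
  proof eventually_elim
    case (elim x)
    show ?case
    proof (rule SUP_least)
      fix \<beta> assume \<beta>: "\<beta> \<in> \<Gamma>\<^sub>0"
      have "exp_density Q \<beta> x \<le> env x" using \<beta> by (auto simp: env_def intro: SUP_upper)
      also have "env x = (env x / S) * S" using S by (simp add: ennreal_divide_times)
      finally have "exp_density Q \<beta> x / (env x / S) \<le> S"
        using S env_pos by (intro divide_le_posI_ennreal) (simp_all add: ennreal_zero_less_divide)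
      then show "ext_ln (exp_density Q \<beta> x / ?r x) \<le> y"
        using elim by (simp add: ext_ln_le_iff y)
    qed
  qed
  then have "esssup Q ?F \<le> y" by (rule esssup_I[OF F])
  then have "minimax_regret Q b \<le> y"
    unfolding minimax_regret_def using R by (intro INF_lower2[of R]) auto
  then show ?thesis by (auto simp: y_def)
qed

text \<open>A real bound K on the regret bounds every log ratio almost everywhere, and the
  divergence is the mean of the log ratio.\<close>

lemma info_div_le_regret:
  assumes R: "R \<in> prob_measures" "absolutely_continuous Q R" and \<beta>: "\<beta> \<in> \<Gamma>\<^sub>0"
  shows "info_div (P \<beta>) R \<le>
    esssup Q (\<lambda>x. SUP \<beta>\<in>\<Gamma>\<^sub>0. ext_ln (exp_density Q \<beta> x / RN_deriv Q R x))" (is "_ \<le> esssup Q ?F")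
proof (rule ereal_le_real)
  fix K :: real assume K: "esssup Q ?F \<le> ereal K"
  have "prob_space R" and sR: "sets R = sets borel" using R by (auto simp: prob_measures_def)
  then interpret R: prob_space R by simp
  define r where "r = RN_deriv Q R"
  have [measurable]: "r \<in> borel_measurable Q" by (simp add: r_def)
  have Rr: "R = density Q r"
    unfolding r_def using R sR by (intro Q.density_RN_deriv[symmetric]) (auto simp: sets_Q)
  have fin: "AE x in Q. r x \<noteq> \<infinity>"
    unfolding r_def using R sR by (intro Q.RN_deriv_finite R.sigma_finite_measure) (auto simp: sets_Q)
  let ?f = "\<lambda>x. ennreal (pd \<beta> x) / r x"
  have f: "AE x in Q. ?f x \<le> ennreal (exp K)"
    using esssup_AE[of ?F Q]
  proof eventually_elim
    case (elim x)
    have "ext_ln (?f x) \<le> ?F x"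
      using \<beta> by (intro SUP_upper2[of \<beta>]) (simp_all add: r_def exp_density_eq trunc_cases(1))
    then have "ext_ln (?f x) \<le> ereal K" using elim K by (meson order_trans)
    then show ?case by (simp add: ext_ln_le_iff ext_exp_def)
  qed
  \<comment> \<open>Where r vanishes the quotient is infinite, which the bound by exp K excludes.
    This is what makes P \<beta> absolutely continuous with respect to R.\<close>
  have "AE x in Q. ennreal (pd \<beta> x) = r x * ?f x"
    using f fin
  proof eventually_elim
    case (elim x)
    then have "r x \<noteq> 0" by (auto simp: top_unique split: if_splits)
    then show ?case using elim by (simp add: ennreal_times_divide less_top mult.commute[of "r x"] ennreal_mult_divide_eq)
  qed
  then have "P \<beta> = density Q (\<lambda>x. r x * ?f x)"
    unfolding exp_family_eq[OF trunc_cases(1)[OF \<beta>]] by (intro density_cong) auto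
  then have P: "P \<beta> = density R ?f"
    by (simp add: Rr density_density_eq)
  have "AE x in P \<beta>. ?f x \<le> ennreal (exp K)"
    unfolding exp_family_eq[OF trunc_cases(1)[OF \<beta>]] using f by (subst AE_density) auto
  moreover interpret P\<beta>: prob_space "P \<beta>" by (rule prob_space_P[OF trunc_cases(1)[OF \<beta>]])
  have "?f \<in> borel_measurable R" unfolding Rr by measurable
  ultimately have "info_div (P \<beta>) R \<le> ereal (\<integral>x. K \<partial>P \<beta>)"
    by (intro info_div_density_le[of R ?f "\<lambda>x. K", folded P] P\<beta>.prob_space_axioms R.prob_space_axioms P\<beta>.integrable_const)
  then show "info_div (P \<beta>) R \<le> ereal K"
    using P\<beta>.prob_space by simp
qed

lemma minimax_redundancy_le_regret: "minimax_redundancy Q b \<le> minimax_regret Q b"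
  unfolding minimax_redundancy_def minimax_regret_def
  by (rule INF_mono) (auto intro!: SUP_least info_div_le_regret)

lemma minimax_redundancy_nonneg: "0 \<le> minimax_redundancy Q b"
  unfolding minimax_redundancy_def
  by (intro INF_greatest SUP_upper2[OF b_in(2)] info_div_nonneg P_in_prob_measures b_in)

lemma minimax_redundancy_finite_iff:
  "minimax_redundancy Q b < \<infinity> \<longleftrightarrow> (\<exists>R\<in>prob_measures. (SUP \<beta>\<in>\<Gamma>\<^sub>0. info_div (P \<beta>) R) < \<infinity>)"
  unfolding minimax_redundancy_def by (rule INF_less_iff)

text \<open>The monadic bind wants a subprobability measure for every real \<beta>; outside \<Gamma>
  the density is 0 and P \<beta> is the zero measure. Measurability in \<beta> is automatic, as a
  pmf carries the discrete \<sigma>-algebra.\<close>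

lemma mixture_in_prob_measures:
  assumes "set_pmf w \<subseteq> \<Gamma>"
  shows "measure_pmf w \<bind> P \<in> prob_measures"
    and "A \<in> sets borel \<Longrightarrow> emeasure (measure_pmf w \<bind> P) A = (\<integral>\<^sup>+\<beta>. emeasure (P \<beta>) A \<partial>measure_pmf w)"
proof -
  have "subprob_space (P \<beta>)" for \<beta>
  proof (cases "\<beta> \<in> \<Gamma>")
    case True
    then show ?thesis by (intro prob_space_imp_subprob_space prob_space_P)
  next
    case False
    then have "exp_density Q \<beta> = (\<lambda>x. 0)" by (intro ext exp_density_outside)
    then show ?thesis by (intro subprob_spaceI) (simp_all add: exp_family_def emeasure_density)
  qed
  then have K: "P \<in> measurable (measure_pmf w) (subprob_algebra borel)"
    by (simp add: measurable_def space_subprob_algebra)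
  have "prob_space (measure_pmf w \<bind> P)"
    using assms by (intro measure_pmf.prob_space_bind[OF _ K] AE_pmfI prob_space_P) auto
  then show "measure_pmf w \<bind> P \<in> prob_measures"
    using sets_bind_measurable[OF K] by (simp add: prob_measures_def)
  show "emeasure (measure_pmf w \<bind> P) A = (\<integral>\<^sup>+\<beta>. emeasure (P \<beta>) A \<partial>measure_pmf w)" if "A \<in> sets borel"
    using emeasure_bind[OF _ K that] by simp
qed

lemma mixture_density:
  assumes fin: "finite (set_pmf w)" and sub: "set_pmf w \<subseteq> \<Gamma>"
  shows "measure_pmf w \<bind> P = density Q (\<lambda>x. ennreal (\<Sum>\<beta>\<in>set_pmf w. pmf w \<beta> * pd \<beta> x))" (is "_ = density Q (\<lambda>x. ennreal (?p x))")
proof (rule measure_eqI)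
  show s: "sets (measure_pmf w \<bind> P) = sets (density Q (\<lambda>x. ennreal (?p x)))"
    using mixture_in_prob_measures(1)[OF sub] by (simp add: prob_measures_def sets_Q)
  fix A assume "A \<in> sets (measure_pmf w \<bind> P)"
  then have A[measurable]: "A \<in> sets borel" by (simp add: s sets_Q)
  have "emeasure (measure_pmf w \<bind> P) A = (\<Sum>\<beta>\<in>set_pmf w. emeasure (P \<beta>) A * ennreal (pmf w \<beta>))"
    using mixture_in_prob_measures(2)[OF sub A] by (simp add: nn_integral_measure_pmf_finite[OF fin])
  also have "\<dots> = (\<Sum>\<beta>\<in>set_pmf w. (\<integral>\<^sup>+x. ennreal (pmf w \<beta> * pd \<beta> x) * indicator A x \<partial>Q))"
  proof (rule sum.cong)
    fix \<beta> assume "\<beta> \<in> set_pmf w"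
    then have "emeasure (P \<beta>) A = (\<integral>\<^sup>+x. ennreal (pd \<beta> x) * indicator A x \<partial>Q)"
      using sub by (subst exp_family_eq) (auto simp: emeasure_density)
    then have "emeasure (P \<beta>) A * ennreal (pmf w \<beta>) = ennreal (pmf w \<beta>) * (\<integral>\<^sup>+x. ennreal (pd \<beta> x) * indicator A x \<partial>Q)"
      by (simp add: mult.commute)
    also have "\<dots> = (\<integral>\<^sup>+x. ennreal (pmf w \<beta>) * (ennreal (pd \<beta> x) * indicator A x) \<partial>Q)"
      by (rule nn_integral_cmult[symmetric]) measurable
    finally show "emeasure (P \<beta>) A * ennreal (pmf w \<beta>) = (\<integral>\<^sup>+x. ennreal (pmf w \<beta> * pd \<beta> x) * indicator A x \<partial>Q)"
      by (simp add: ennreal_mult' mult.assoc)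
  qed simp
  also have "\<dots> = (\<integral>\<^sup>+x. (\<Sum>\<beta>\<in>set_pmf w. ennreal (pmf w \<beta> * pd \<beta> x) * indicator A x) \<partial>Q)"
    by (rule nn_integral_sum[symmetric]) measurable
  also have "\<dots> = emeasure (density Q (\<lambda>x. ennreal (?p x))) A"
    by (subst emeasure_density) (auto intro!: nn_integral_cong simp: sum_distrib_right[symmetric] sum_ennreal)
  finally show "emeasure (measure_pmf w \<bind> P) A = emeasure (density Q (\<lambda>x. ennreal (?p x))) A" .
qed

text \<open>
  Let $h$ be the envelope, $\bar p$ the mixture density and $S$ the Shtarkov integral. Since
  $p_\beta \le h$, we have
  $\ln (p_\beta / \bar p) \le \ln S - 1 + h / (S \bar p)$, and averaging over $\beta$ leaves
  $\ln S - 1 + \frac{1}{S} \int h \, dQ = \ln S$.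
\<close>
lemma mutual_info_le_shtarkov:
  assumes S: "shtarkov Q b < \<infinity>" and fin: "finite (set_pmf w)" and sub: "set_pmf w \<subseteq> \<Gamma>\<^sub>0"
  shows "mutual_info Q w \<le> ereal (ln (enn2real (shtarkov Q b)))"
proof -
  define Sr where "Sr = enn2real (shtarkov Q b)"
  have Sr: "shtarkov Q b = ennreal Sr" "0 < Sr"
    using S shtarkov_ge_1 by (auto simp: Sr_def enn2real_positive_iff intro: less_le_trans[of 0 1])
  define h where "h x = enn2real (env x)" for x
  have h_meas[measurable]: "h \<in> borel_measurable Q" unfolding h_def by measurable
  have "AE x in Q. env x \<noteq> \<infinity>"
    using S by (intro nn_integral_noteq_infinite) (auto simp: shtarkov_eq)
  then have env_h: "AE x in Q. env x = ennreal (h x)"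
    by eventually_elim (simp add: h_def less_top)
  have nh: "(\<integral>\<^sup>+x. ennreal (h x) \<partial>Q) = ennreal Sr"
    using nn_integral_cong_AE[OF env_h] Sr(1) by (simp add: shtarkov_eq)
  have h0: "0 \<le> h x" for x by (simp add: h_def)
  have ih: "integrable Q h"
    using nh h0 by (intro integrableI_nonneg) auto
  have Ih: "(\<integral>x. h x \<partial>Q) = Sr"
    using nh nn_integral_eq_integral[OF ih] h0 Sr(2) by (simp add: integral_nonneg_AE)
  let ?W = "set_pmf w"
  have subG: "?W \<subseteq> \<Gamma>" using sub trunc_cases(1) by auto
  define p where "p x = (\<Sum>\<beta>\<in>?W. pmf w \<beta> * pd \<beta> x)" for x
  have p_meas[measurable]: "p \<in> borel_measurable Q" unfolding p_def by measurable
  have p_pos: "0 < p x" for x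
    unfolding p_def using fin set_pmf_not_empty by (intro sum_pos) (auto simp: pmf_positive)
  have p_ge: "pmf w \<beta> * pd \<beta> x \<le> p x" if "\<beta> \<in> ?W" for \<beta> x
    unfolding p_def using fin that by (intro member_le_sum[of \<beta> ?W]) auto
  define R where "R = measure_pmf w \<bind> P"
  have R: "R = density Q (\<lambda>x. ennreal (p x))"
    unfolding R_def p_def by (rule mixture_density[OF fin subG])
  have pR: "prob_space R"
    using mixture_in_prob_measures(1)[OF subG] by (simp add: R_def prob_measures_def)
  define I where "I \<beta> = (\<integral>x. pd \<beta> x * (h x / p x) \<partial>Q)" for \<beta>
  have iI: "integrable Q (\<lambda>x. pd \<beta> x * (h x / p x))" if \<beta>: "\<beta> \<in> ?W" for \<beta>
  proof (rule Bochner_Integration.integrable_bound)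
    show "integrable Q (\<lambda>x. h x / pmf w \<beta>)" using ih by simp
    \<comment> \<open>The mixture density is at least its own \<beta> term, so the integrand is at
      most h divided by the weight of \<beta>.\<close>
    have "pd \<beta> x * (h x / p x) \<le> h x / pmf w \<beta>" for x
    proof -
      have "(pmf w \<beta> * pd \<beta> x) * h x \<le> p x * h x" by (intro mult_right_mono p_ge \<beta> h0)
      then show ?thesis using p_pos[of x] pmf_positive[OF \<beta>] by (simp add: field_simps)
    qed
    then show "AE x in Q. norm (pd \<beta> x * (h x / p x)) \<le> norm (h x / pmf w \<beta>)"
      using h0 p_pos by (intro AE_I2) (simp add: abs_mult less_imp_le abs_of_pos)
  qed measurable
  have div: "info_div (P \<beta>) R \<le> ereal (ln Sr - 1 + I \<beta> / Sr)" if \<beta>: "\<beta> \<in> ?W" for \<beta>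
  proof -
    have \<beta>G: "\<beta> \<in> \<Gamma>" "\<beta> \<in> \<Gamma>\<^sub>0" using \<beta> sub subG by auto
    let ?f = "\<lambda>x. ennreal (pd \<beta> x / p x)" and ?g = "\<lambda>x. ln Sr - 1 + h x / p x / Sr"
    have "density R ?f = density Q (\<lambda>x. ennreal (p x) * ?f x)"
      unfolding R by (rule density_density_eq) measurable
    also have "\<dots> = P \<beta>"
      unfolding exp_family_eq[OF \<beta>G(1)] using p_pos
      by (intro density_cong) (auto intro!: AE_I2 simp: ennreal_mult'[symmetric] less_imp_le less_imp_neq[symmetric])
    finally have f: "density R ?f = P \<beta>" .
    have i1: "integrable (P \<beta>) (\<lambda>x. h x / p x)" "(\<integral>x. h x / p x \<partial>P \<beta>) = I \<beta>"
      unfolding exp_family_eq[OF \<beta>G(1)] using iI[OF \<beta>] by (simp_all add: integrable_density integral_density I_def)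
    interpret P: prob_space "P \<beta>" by (rule prob_space_P) fact
    have "AE x in Q. ?f x \<le> ennreal (exp (?g x))"
      using env_h
    proof eventually_elim
      case (elim x)
      have "ennreal (pd \<beta> x) \<le> ennreal (h x)" using pd_le_env[OF \<beta>G(2), of x] elim by simp
      then have le: "pd \<beta> x / p x \<le> h x / p x" using p_pos[of x] h0[of x] by (simp add: divide_right_mono)
      \<comment> \<open>The tangent bound ln t \<le> t - 1 at this t is exact where h / p equals S,
        that is, where p is the normalized maximum likelihood density.\<close>
      define t where "t = h x / p x / Sr"
      have "t \<le> exp (t - 1)" using exp_ge_add_one_self[of "t - 1"] by simp
      then have "Sr * t \<le> Sr * exp (t - 1)" using Sr by simp
      also have "\<dots> = exp (?g x)" using Sr by (simp add: t_def exp_add exp_diff)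
      finally have "h x / p x \<le> exp (?g x)" using Sr by (simp add: t_def)
      then show ?case using le by (intro ennreal_leI) simp
    qed
    then have AEf: "AE x in P \<beta>. ?f x \<le> ennreal (exp (?g x))"
      unfolding exp_family_eq[OF \<beta>G(1)] by (subst AE_density) auto
    have "info_div (density R ?f) R \<le> ereal (\<integral>x. ?g x \<partial>density R ?f)"
    proof (rule info_div_density_le)
      show "integrable (density R ?f) ?g"
        unfolding f by (intro Bochner_Integration.integrable_add integrable_divide i1 P.integrable_const)
      show "prob_space (density R ?f)" unfolding f by (rule P.prob_space_axioms)
      show "AE x in density R ?f. ?f x \<le> ennreal (exp (?g x))" unfolding f by (rule AEf)
      show "?f \<in> borel_measurable R" unfolding R by measurable
    qed (rule pR)
    also have "(\<integral>x. ?g x \<partial>density R ?f) = ln Sr - 1 + I \<beta> / Sr"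
      unfolding f using P.prob_space i1
      by (subst Bochner_Integration.integral_add) (simp_all del: divide_divide_eq_left)
    finally show ?thesis by (simp add: f)
  qed
  have sumI: "(\<Sum>\<beta>\<in>?W. pmf w \<beta> * I \<beta>) = Sr"
  proof -
    have "(\<Sum>\<beta>\<in>?W. pmf w \<beta> * I \<beta>) = (\<integral>x. (\<Sum>\<beta>\<in>?W. pmf w \<beta> * (pd \<beta> x * (h x / p x))) \<partial>Q)"
      unfolding I_def integral_mult_right_zero[symmetric]
      by (rule Bochner_Integration.integral_sum[symmetric]) (intro integrable_mult_right iI)
    also have "\<dots> = (\<integral>x. h x \<partial>Q)"
    proof (intro Bochner_Integration.integral_cong refl)
      fix x
      have "(\<Sum>\<beta>\<in>?W. pmf w \<beta> * (pd \<beta> x * (h x / p x))) = p x * (h x / p x)"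
        unfolding p_def[of x] sum_distrib_right by (simp add: mult.assoc p_def)
      then show "(\<Sum>\<beta>\<in>?W. pmf w \<beta> * (pd \<beta> x * (h x / p x))) = h x" using p_pos[of x] by simp
    qed
    finally show ?thesis by (simp add: Ih)
  qed
  have "mutual_info Q w \<le> (\<Sum>\<beta>\<in>?W. ereal (pmf w \<beta>) * ereal (ln Sr - 1 + I \<beta> / Sr))"
    unfolding mutual_info_def R_def[symmetric] by (intro sum_mono ereal_mult_left_mono div) auto
  also have "\<dots> = ereal (\<Sum>\<beta>\<in>?W. pmf w \<beta> * (ln Sr - 1) + pmf w \<beta> * I \<beta> / Sr)"
    by (simp add: distrib_left)
  also have "(\<Sum>\<beta>\<in>?W. pmf w \<beta> * (ln Sr - 1) + pmf w \<beta> * I \<beta> / Sr) = (\<Sum>\<beta>\<in>?W. pmf w \<beta>) * (ln Sr - 1) + (\<Sum>\<beta>\<in>?W. pmf w \<beta> * I \<beta>) / Sr"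
    by (simp add: sum.distrib sum_distrib_right sum_divide_distrib)
  also have "\<dots> = ln Sr"
    using Sr sum_pmf_eq_1[OF fin order_refl] by (simp add: sumI)
  finally show ?thesis by (simp add: Sr_def)
qed

lemma shtarkov_finite_imp_capacity_finite:
  assumes "shtarkov Q b < \<infinity>" shows "\<bar>capacity Q b\<bar> \<noteq> \<infinity>"
proof -
  have "capacity Q b \<le> ereal (ln (enn2real (shtarkov Q b)))"
    unfolding capacity_def by (rule SUP_least) (auto intro: mutual_info_le_shtarkov[OF assms])
  \<comment> \<open>A point mass keeps the supremum above minus infinity.\<close>
  moreover have "mutual_info Q (return_pmf b) \<le> capacity Q b"
    unfolding capacity_def using b_in by (intro SUP_upper) auto
  moreover have "- \<infinity> < mutual_info Q (return_pmf b)"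
    by (simp add: mutual_info_def info_div_def)
  ultimately show ?thesis by auto
qed

section \<open>Escape of mass\<close>

text \<open>Since \<beta> \<ge> b, the likelihood ratio against P_b is nondecreasing in x, so its
  value at m is an upper bound on the left of m and a lower bound on the right. Comparing the two
  kinds of bound eliminates \<open>log_Z\<close>.\<close>

lemma prob_le_exp_Iic:
  assumes "\<beta> \<in> \<Gamma>\<^sub>0"
  shows "measure (P \<beta>) {..m} \<le> exp ((\<beta> - b) * m - (log_Z \<beta> - log_Z b)) * measure (P b) {..m}"
proof -
  let ?g = "\<lambda>x. (\<beta> - b) * x - (log_Z \<beta> - log_Z b)"
  interpret Pb: prob_space "P b" by (rule prob_space_P[OF b_in(1)])
  interpret P\<beta>: prob_space "P \<beta>" by (rule prob_space_P[OF trunc_cases(1)[OF assms]])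
  have "emeasure (P \<beta>) {..m} = (\<integral>\<^sup>+x. ennreal (exp (?g x)) * indicator {..m} x \<partial>P b)"
    unfolding P_density[OF trunc_cases(1)[OF assms] b_in(1)] by (subst emeasure_density) auto
  also have "\<dots> \<le> (\<integral>\<^sup>+x. ennreal (exp (?g m)) * indicator {..m} x \<partial>P b)"
    using trunc_cases(2)[OF assms]
    by (intro nn_integral_mono) (auto simp: indicator_def mult_left_mono intro!: ennreal_leI)
  also have "\<dots> = ennreal (exp (?g m)) * emeasure (P b) {..m}"
    by (rule nn_integral_cmult_indicator) simp
  finally show ?thesis
    by (simp add: P\<beta>.emeasure_eq_measure Pb.emeasure_eq_measure ennreal_mult'[symmetric])
qed

lemma prob_ge_exp_Ioi:
  assumes "\<beta> \<in> \<Gamma>\<^sub>0"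
  shows "exp ((\<beta> - b) * m - (log_Z \<beta> - log_Z b)) * measure (P b) {m<..} \<le> measure (P \<beta>) {m<..}"
proof -
  let ?g = "\<lambda>x. (\<beta> - b) * x - (log_Z \<beta> - log_Z b)"
  interpret Pb: prob_space "P b" by (rule prob_space_P[OF b_in(1)])
  interpret P\<beta>: prob_space "P \<beta>" by (rule prob_space_P[OF trunc_cases(1)[OF assms]])
  have "ennreal (exp (?g m)) * emeasure (P b) {m<..} = (\<integral>\<^sup>+x. ennreal (exp (?g m)) * indicator {m<..} x \<partial>P b)"
    by (rule nn_integral_cmult_indicator[symmetric]) simp
  also have "\<dots> \<le> (\<integral>\<^sup>+x. ennreal (exp (?g x)) * indicator {m<..} x \<partial>P b)"
    using trunc_cases(2)[OF assms]
    by (intro nn_integral_mono) (auto simp: indicator_def mult_left_mono intro!: ennreal_leI)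
  also have "\<dots> = emeasure (P \<beta>) {m<..}"
    unfolding P_density[OF trunc_cases(1)[OF assms] b_in(1)] by (subst emeasure_density) auto
  finally show ?thesis
    by (simp add: P\<beta>.emeasure_eq_measure Pb.emeasure_eq_measure ennreal_mult'[symmetric])
qed

lemma emeasure_P_eq_0_iff:
  assumes "\<beta> \<in> \<Gamma>" "A \<in> sets borel"
  shows "emeasure (P \<beta>) A = 0 \<longleftrightarrow> emeasure Q A = 0"
proof -
  have "A \<in> null_sets (P \<beta>) \<longleftrightarrow> A \<in> null_sets Q"
    unfolding exp_family_eq[OF assms(1)]
    by (subst null_sets_density_iff) (use assms(2) in \<open>auto simp: sets_Q AE_iff_null_sets[symmetric]\<close>)
  then show ?thesis using assms(2) by (auto simp: null_sets_def sets_Q)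
qed

text \<open>These are the points strictly below the essential supremum of x under Q. The set
  represents that upper end whether it is finite or infinite.\<close>

definition upper_charged :: "real set" where
  "upper_charged = {m. emeasure Q {m<..} \<noteq> 0}"

text \<open>The open half line is a countable union of smaller ones, which cannot all be null. Hence
  there is always room between m and the upper end.\<close>

lemma upper_charged_greater:
  assumes "m \<in> upper_charged" shows "\<exists>m'>m. m' \<in> upper_charged"
proof (rule ccontr)
  assume *: "\<not> ?thesis"
  have "{m<..} = (\<Union>n::nat. {m + 1 / real (Suc n)<..})"
  proof (intro set_eqI iffI)
    fix x assume "x \<in> {m<..}"
    then obtain n where "inverse (real (Suc n)) < x - m" using reals_Archimedean[of "x - m"] by auto
    then show "x \<in> (\<Union>n::nat. {m + 1 / real (Suc n)<..})" by (auto simp: inverse_eq_divide intro!: exI[of _ n])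
  qed (auto intro: less_trans[rotated] simp: add_strict_increasing)
  moreover have "(\<Union>n::nat. {m + 1 / real (Suc n)<..}) \<in> null_sets Q"
    using * by (intro null_sets_UN) (auto simp: null_sets_def sets_Q upper_charged_def)
  ultimately show False using assms by (auto simp: upper_charged_def null_sets_def)
qed

lemma upper_charged_nonempty: "\<exists>m. m \<in> upper_charged"
proof (rule ccontr)
  assume *: "\<not> ?thesis"
  have "UNIV = (\<Union>n::nat. {- real n<..})"
  proof (intro set_eqI iffI)
    fix x :: real
    obtain n :: nat where "- x < real n" using reals_Archimedean2 by blast
    then show "x \<in> (\<Union>n::nat. {- real n<..})" by (auto intro!: exI[of _ n])
  qed auto
  moreover have "(\<Union>n::nat. {- real n<..}) \<in> null_sets Q"
    using * by (intro null_sets_UN) (auto simp: null_sets_def sets_Q upper_charged_def)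
  ultimately show False using Q_nonzero by (auto simp: null_sets_def)
qed

lemma eventually_interior: "\<forall>\<^sub>F \<beta> in up_to (beta_sup Q). b \<le> \<beta> \<and> ereal \<beta> < beta_sup Q"
proof (cases "beta_sup Q")
  case (real s)
  then show ?thesis
    using less_beta_sup eventually_at_left_real[of b s] by (auto simp: up_to_def elim!: eventually_mono)
qed (use less_beta_sup in \<open>auto simp: up_to_def eventually_ge_at_top\<close>)

lemma eventually_trunc: "\<forall>\<^sub>F \<beta> in up_to (beta_sup Q). \<beta> \<in> \<Gamma>\<^sub>0"
  using eventually_interior by eventually_elim (auto intro: interior_in_trunc)

text \<open>
  On $x \le k$ one has $e^{\beta x} \ge \frac{1}{2} e^{sx}$ once $(s - \beta) k \le \ln 2$; this gives the limit without any monotonicity of $Z$.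
\<close>
lemma Z_tends_to_infinity_at_sup:
  assumes s: "beta_sup Q = ereal s" "s \<notin> \<Gamma>" and K: "0 < K"
  shows "\<forall>\<^sub>F \<beta> in up_to (beta_sup Q). K \<le> Z \<beta>"
proof -
  have inf: "(\<integral>\<^sup>+x. ennreal (exp (s * x)) \<partial>Q) = \<infinity>"
    using s(2) by (simp add: can_params_def partition_fun_def less_top[symmetric])
  let ?F = "\<lambda>k x. ennreal (exp (s * x)) * indicator {..real k} x"
  have "(\<integral>\<^sup>+x. ennreal (exp (s * x)) \<partial>Q) = (\<integral>\<^sup>+x. (SUP k. ?F k x) \<partial>Q)"
  proof (intro nn_integral_cong antisym)
    fix x
    obtain n :: nat where n: "x < real n" using reals_Archimedean2 by blast
    then have "ennreal (exp (s * x)) = ?F n x" by simp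
    also have "\<dots> \<le> (SUP k. ?F k x)" by (rule SUP_upper) simp
    finally show "ennreal (exp (s * x)) \<le> (SUP k. ?F k x)" .
    show "(SUP k. ?F k x) \<le> ennreal (exp (s * x))"
      by (rule SUP_least) (auto simp: indicator_def)
  qed
  also have "\<dots> = (SUP k. \<integral>\<^sup>+x. ?F k x \<partial>Q)"
    by (intro nn_integral_monotone_convergence_SUP) (auto simp: incseq_def le_fun_def indicator_def)
  \<comment> \<open>The factor 2 makes up for the 1/2 lost in passing from exp (s x) to exp (\<beta>
    x).\<close>
  finally have "ennreal (2 * K) < (SUP k. \<integral>\<^sup>+x. ?F k x \<partial>Q)" by (simp add: inf)
  then obtain k where k: "ennreal (2 * K) < (\<integral>\<^sup>+x. ?F k x \<partial>Q)" by (auto simp: less_SUP_iff)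
  \<comment> \<open>Taking Suc k instead of k avoids a division by zero.\<close>
  have "\<forall>\<^sub>F \<beta> in at_left s. s - ln 2 / real (Suc k) < \<beta> \<and> \<beta> < s"
    using eventually_at_left_real[of "s - ln 2 / real (Suc k)" s] by (simp add: greaterThanLessThan_iff)
  then have "\<forall>\<^sub>F \<beta> in up_to (beta_sup Q). s - ln 2 / real (Suc k) < \<beta> \<and> \<beta> < s"
    by (simp add: up_to_def s)
  then show ?thesis using eventually_trunc
  proof eventually_elim
    case (elim \<beta>)
    have "(s - \<beta>) * real k \<le> (s - \<beta>) * real (Suc k)" using elim by (intro mult_left_mono) auto
    also have "\<dots> \<le> ln 2" using elim by (simp add: field_simps)
    finally have sk: "(s - \<beta>) * real k \<le> ln 2" .
    have "ennreal (1 / 2) * ?F k x \<le> ennreal (exp (\<beta> * x))" for x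
    proof (cases "x \<le> real k")
      case True
      have "(s - \<beta>) * x \<le> (s - \<beta>) * real k" using True elim by (intro mult_left_mono) auto
      then have "s * x - ln 2 \<le> \<beta> * x" using sk by (simp add: algebra_simps)
      then have "exp (s * x - ln 2) \<le> exp (\<beta> * x)" by simp
      then have "1 / 2 * exp (s * x) \<le> exp (\<beta> * x)" by (simp add: exp_diff)
      then show ?thesis using True by (simp add: ennreal_mult'[symmetric] ennreal_leI del: ennreal_half)
    qed simp
    then have "(\<integral>\<^sup>+x. ennreal (1 / 2) * ?F k x \<partial>Q) \<le> (\<integral>\<^sup>+x. ennreal (exp (\<beta> * x)) \<partial>Q)"
      by (intro nn_integral_mono)
    then have "ennreal (1 / 2) * (\<integral>\<^sup>+x. ?F k x \<partial>Q) \<le> ennreal (Z \<beta>)"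
      using trunc_cases(1)[OF elim(2)] by (simp add: nn_integral_cmult nn_integral_exp)
    moreover have "ennreal (1 / 2) * ennreal (2 * K) \<le> ennreal (1 / 2) * (\<integral>\<^sup>+x. ?F k x \<partial>Q)"
      using k by (intro mult_left_mono) auto
    ultimately have "ennreal (1 / 2) * ennreal (2 * K) \<le> ennreal (Z \<beta>)" by (rule order_trans[rotated])
    then show "K \<le> Z \<beta>"
      using Z_pos[OF trunc_cases(1)[OF elim(2)]] K by (simp add: ennreal_mult'[symmetric] del: ennreal_half)
  qed
qed

text \<open>At a finite end the normalizer Z \<beta> tends to infinity while the tilt at m stays
  bounded. At an infinite end, comparison with a charged point m' > m cancels the normalizer and
  leaves exp (- (\<beta> - b) (m' - m)) / P_b(m', \<infinity>).\<close>

lemma lower_part_vanishes: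
  assumes nc: "\<not> closed_above" and m: "m \<in> upper_charged" and \<epsilon>: "0 < \<epsilon>"
  shows "\<forall>\<^sub>F \<beta> in up_to (beta_sup Q). measure (P \<beta>) {..m} < \<epsilon>"
proof (cases "beta_sup Q")
  case (real s)
  then have s: "s \<notin> \<Gamma>" using nc by (auto simp: closed_above_def)
  define C where "C = exp ((s - b) * \<bar>m\<bar>) * Z b"
  have C: "0 < C" using Z_pos[OF b_in(1)] by (simp add: C_def)
  \<comment> \<open>The bound obtained below is C / Z \<beta>; the factor 2 makes the final
    inequality strict.\<close>
  have "\<forall>\<^sub>F \<beta> in up_to (beta_sup Q). 2 * C / \<epsilon> \<le> Z \<beta>"
    using C \<epsilon> by (intro Z_tends_to_infinity_at_sup[OF real s]) simp
  then show ?thesis using eventually_trunc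
  proof eventually_elim
    case (elim \<beta>)
    note \<beta> = trunc_cases[OF elim(2)]
    have "(\<beta> - b) * m \<le> (\<beta> - b) * \<bar>m\<bar>" using \<beta> by (intro mult_left_mono) auto
    also have "\<dots> \<le> (s - b) * \<bar>m\<bar>" using \<beta> real by (intro mult_right_mono) auto
    finally have "exp ((\<beta> - b) * m - (log_Z \<beta> - log_Z b)) \<le> exp ((s - b) * \<bar>m\<bar> - (log_Z \<beta> - log_Z b))" by simp
    also have "\<dots> = C / Z \<beta>"
      using \<beta>(1) b_in(1) by (simp add: C_def exp_diff exp_log_Z)
    also have "\<dots> < \<epsilon>"
      using elim(1) C \<epsilon> Z_pos[OF \<beta>(1)] by (simp add: field_simps)
    finally have *: "exp ((\<beta> - b) * m - (log_Z \<beta> - log_Z b)) < \<epsilon>" .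
    have "measure (P \<beta>) {..m} \<le> exp ((\<beta> - b) * m - (log_Z \<beta> - log_Z b)) * measure (P b) {..m}"
      by (rule prob_le_exp_Iic[OF elim(2)])
    also have "\<dots> \<le> exp ((\<beta> - b) * m - (log_Z \<beta> - log_Z b)) * 1"
      using prob_space.prob_le_1[OF prob_space_P[OF b_in(1)]] by (intro mult_left_mono) auto
    finally show ?case using * by simp
  qed
next
  case PInf
  obtain m' where m': "m < m'" "m' \<in> upper_charged" using upper_charged_greater[OF m] by auto
  interpret Pb: prob_space "P b" by (rule prob_space_P[OF b_in(1)])
  define \<gamma> where "\<gamma> = measure (P b) {m'<..}"
  have "\<gamma> \<noteq> 0"
    using m'(2) emeasure_P_eq_0_iff[OF b_in(1), of "{m'<..}"] by (auto simp: \<gamma>_def upper_charged_def Pb.emeasure_eq_measure)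
  then have \<gamma>: "0 < \<gamma>" by (simp add: \<gamma>_def zero_less_measure_iff)
  have "((\<lambda>\<beta>. exp (- ((\<beta> - b) * (m' - m))) / \<gamma>) \<longlongrightarrow> 0) at_top"
    using m'(1) \<gamma> by real_asymp
  then have "\<forall>\<^sub>F \<beta> in up_to (beta_sup Q). exp (- ((\<beta> - b) * (m' - m))) / \<gamma> < \<epsilon>"
    using \<epsilon> by (simp add: up_to_def PInf order_tendstoD(2))
  then show ?thesis using eventually_trunc
  proof eventually_elim
    case (elim \<beta>)
    let ?k = "log_Z \<beta> - log_Z b"
    have 1: "measure (P \<beta>) {..m} \<le> exp ((\<beta> - b) * m - ?k) * 1"
      using Pb.prob_le_1[of "{..m}"] by (intro order_trans[OF prob_le_exp_Iic[OF elim(2)]] mult_left_mono) auto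
    have "exp ((\<beta> - b) * m' - ?k) * \<gamma> \<le> 1"
      unfolding \<gamma>_def using prob_space.prob_le_1[OF prob_space_P[OF trunc_cases(1)[OF elim(2)]]]
      by (rule order_trans[OF prob_ge_exp_Ioi[OF elim(2)]])
    then have "exp (- ((\<beta> - b) * (m' - m))) * (exp ((\<beta> - b) * m' - ?k) * \<gamma>) \<le> exp (- ((\<beta> - b) * (m' - m))) * 1"
      by (rule mult_left_mono) simp
    moreover have "exp (- ((\<beta> - b) * (m' - m))) * exp ((\<beta> - b) * m' - ?k) = exp ((\<beta> - b) * m - ?k)"
      by (simp add: exp_add[symmetric] algebra_simps)
    ultimately have "exp ((\<beta> - b) * m - ?k) \<le> exp (- ((\<beta> - b) * (m' - m))) / \<gamma>"
      using \<gamma> by (simp only: pos_le_divide_eq mult.assoc[symmetric] mult_1_right)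
    then show ?case using 1 elim(1) by simp
  qed
qed (use less_beta_sup in auto)

text \<open>If the support is bounded above by M, then exp (\<beta> x) \<le> exp ((\<beta> - b) M)
  exp (b x) puts every \<beta> \<ge> b into \<Gamma>. So a top atom already forces
  \<open>beta_sup Q\<close> to be infinite, as \<open>closed_above\<close> demands.\<close>

lemma no_top_atom:
  assumes nc: "\<not> closed_above" shows "\<not> top_atom M"
proof
  assume M: "top_atom M"
  have "\<beta> \<in> \<Gamma>" if "b \<le> \<beta>" for \<beta>
  proof (rule can_paramsI, rule Bochner_Integration.integrable_bound)
    show "integrable Q (\<lambda>x. exp ((\<beta> - b) * M) * exp (b * x))"
      using exp_integrable[OF b_in(1)] by simp
    show "AE x in Q. norm (exp (\<beta> * x)) \<le> norm (exp ((\<beta> - b) * M) * exp (b * x))"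
      using conjunct2[OF M[unfolded top_atom_def]]
    proof eventually_elim
      case (elim x)
      then have "(\<beta> - b) * x \<le> (\<beta> - b) * M" using that by (intro mult_left_mono) auto
      then have "\<beta> * x \<le> (\<beta> - b) * M + b * x" by (simp add: algebra_simps)
      then show ?case by (simp add: exp_add[symmetric])
    qed
  qed measurable
  then have *: "ereal \<beta> \<le> beta_sup Q" if "b \<le> \<beta>" for \<beta>
    using that unfolding beta_sup_def by (auto intro: SUP_upper)
  have "beta_sup Q = \<infinity>"
  proof (cases "beta_sup Q")
    case (real s)
    then show ?thesis using *[of "s + 1"] less_beta_sup by auto
  qed (use less_beta_sup in auto)
  then show False using nc M by (auto simp: closed_above_def)
qed

text \<open>Continuity from above along half lines that shrink to the upper end. If that end is
  infinite they intersect in the empty set; if it is M they intersect in [M, \<infinity>), which is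
  null because M is not an atom.\<close>

lemma upper_part_small:
  assumes nc: "\<not> closed_above" and \<beta>: "\<beta> \<in> \<Gamma>\<^sub>0" and \<epsilon>: "0 < \<epsilon>"
  shows "\<exists>m\<in>upper_charged. measure (P \<beta>) {m<..} < \<epsilon>"
proof -
  interpret P\<beta>: prob_space "P \<beta>" by (rule prob_space_P[OF trunc_cases(1)[OF \<beta>]])
  have down: "m \<in> upper_charged" if "m' \<in> upper_charged" "m \<le> m'" for m m'
  proof -
    have "emeasure Q {m'<..} \<le> emeasure Q {m<..}" using that by (intro emeasure_mono) (auto simp: sets_Q)
    then show ?thesis using that by (auto simp: upper_charged_def)
  qed
  have seq: "\<exists>n. measure (P \<beta>) {f n<..} < \<epsilon>"
    if f: "incseq f" "measure (P \<beta>) (\<Inter>n. {f n<..}) = 0" for f :: "nat \<Rightarrow> real"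
  proof -
    have "(\<lambda>n. measure (P \<beta>) {f n<..}) \<longlonglongrightarrow> measure (P \<beta>) (\<Inter>n. {f n<..})"
      using f(1) by (intro P\<beta>.finite_Lim_measure_decseq) (auto simp: decseq_def incseq_def intro: le_less_trans)
    then have "\<forall>\<^sub>F n in sequentially. measure (P \<beta>) {f n<..} < \<epsilon>"
      using \<epsilon> by (simp add: f(2) order_tendstoD(2))
    then show ?thesis by (auto simp: eventually_sequentially)
  qed
  show ?thesis
  proof (cases "bdd_above upper_charged")
    case False
    then have all: "m \<in> upper_charged" for m
      using down by (meson bdd_aboveI linear)
    have "(\<Inter>n. {real n<..}) = {}" by (auto simp: not_less) (meson not_less real_arch_simple)
    then show ?thesis using seq[of real] all by (auto simp: incseq_def)
  next
    case True
    define M where "M = Sup upper_charged"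
    obtain m0 where m0: "m0 \<in> upper_charged" using upper_charged_nonempty by auto
    have le: "m \<le> M" if "m \<in> upper_charged" for m
      using that True by (auto simp: M_def intro: cSup_upper)
    \<comment> \<open>A set without largest element does not attain its supremum, so nothing lies
      beyond M.\<close>
    then have "M \<notin> upper_charged" using upper_charged_greater[of M] by fastforce
    then have null: "{M<..} \<in> null_sets Q" by (simp add: upper_charged_def null_sets_def sets_Q)
    then have "AE x in Q. x \<le> M" using AE_not_in[OF null] by (simp add: not_less)
    then have "emeasure Q {M} = 0" using no_top_atom[OF nc, of M] by (simp add: top_atom_def)
    then have "{M} \<in> null_sets Q" by (simp add: null_sets_def sets_Q)
    with null have "{M<..} \<union> {M} \<in> null_sets Q" by (rule null_sets.Un)
    moreover have "{M<..} \<union> {M} = {M..}" by auto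
    ultimately have "emeasure (P \<beta>) {M..} = 0"
      using trunc_cases(1)[OF \<beta>] by (subst emeasure_P_eq_0_iff) (auto simp: null_sets_def)
    then have 0: "measure (P \<beta>) {M..} = 0" by (simp add: measure_def)
    let ?f = "\<lambda>n. M - 1 / real (Suc n)"
    have "?f n \<in> upper_charged" for n
    proof -
      have "\<exists>m\<in>upper_charged. ?f n < m"
        using m0 less_cSup_iff[OF _ True, of "?f n"] by (auto simp: M_def)
      then show ?thesis using down by (auto intro: less_imp_le)
    qed
    moreover have "(\<Inter>n. {?f n<..}) = {M..}"
    proof (intro set_eqI iffI)
      fix x assume x: "x \<in> (\<Inter>n. {?f n<..})"
      show "x \<in> {M..}"
      proof (rule ccontr)
        assume "x \<notin> {M..}"
        then obtain n where "inverse (real (Suc n)) < M - x" using reals_Archimedean[of "M - x"] by auto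
        moreover have "?f n < x" using x by blast
        ultimately show False by (simp add: inverse_eq_divide)
      qed
    next
      fix x assume "x \<in> {M..}"
      then have "?f n < x" for n
        using divide_pos_pos[of 1 "real (Suc n)"] by (simp only: atLeast_iff) linarith
      then show "x \<in> (\<Inter>n. {?f n<..})" by blast
    qed
    moreover have "incseq ?f" by (auto simp: incseq_def frac_le)
    ultimately show ?thesis using seq[of ?f] 0 by auto
  qed
qed

text \<open>Given m, the parameter is chosen to clear the mass below m and m' afterwards to cut off
  its upper tail. Losing less than 1/4 on each side leaves more than 1/2.\<close>

lemma escaping_step:
  assumes nc: "\<not> closed_above" and m: "m \<in> upper_charged"
  shows "\<exists>\<beta>\<in>\<Gamma>\<^sub>0. \<exists>m'\<in>upper_charged. m \<le> m' \<and> 1 / 2 < measure (P \<beta>) {m<..m'}"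
proof -
  have "\<forall>\<^sub>F \<beta> in up_to (beta_sup Q). measure (P \<beta>) {..m} < 1 / 4 \<and> \<beta> \<in> \<Gamma>\<^sub>0"
    by (intro eventually_conj lower_part_vanishes[OF nc m] eventually_trunc) simp
  moreover have "up_to (beta_sup Q) \<noteq> bot" by (simp add: up_to_def)
  ultimately obtain \<beta> where \<beta>: "measure (P \<beta>) {..m} < 1 / 4" "\<beta> \<in> \<Gamma>\<^sub>0"
    using eventually_happens' by blast
  obtain m' where m': "m' \<in> upper_charged" "measure (P \<beta>) {m'<..} < 1 / 4"
    using upper_part_small[OF nc \<beta>(2), of "1 / 4"] by auto
  interpret P\<beta>: prob_space "P \<beta>" by (rule prob_space_P[OF trunc_cases(1)[OF \<beta>(2)]])
  have "{..m} \<union> {m<..m'} \<union> {m'<..} = UNIV" by auto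
  then have "measure (P \<beta>) ({..m} \<union> {m<..m'} \<union> {m'<..}) = 1"
    using P\<beta>.prob_space by simp
  moreover have "measure (P \<beta>) ({..m} \<union> {m<..m'} \<union> {m'<..})
      \<le> measure (P \<beta>) ({..m} \<union> {m<..m'}) + measure (P \<beta>) {m'<..}"
    by (rule measure_Un_le) simp_all
  moreover have "measure (P \<beta>) ({..m} \<union> {m<..m'}) \<le> measure (P \<beta>) {..m} + measure (P \<beta>) {m<..m'}"
    by (rule measure_Un_le) simp_all
  ultimately have half: "1 / 2 < measure (P \<beta>) {m<..m'}" using \<beta>(1) m'(2) by linarith
  then have "m < m'" by (rule contrapos_pp) simp
  then show ?thesis using \<beta>(2) m'(1) half by (intro bexI[of _ \<beta>] bexI[of _ m'] conjI) auto
qed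

text \<open>Each interval starts where the previous one ends. More than 1/2 on each of two disjoint
  sets is impossible for one probability measure, so the parameters are distinct; a uniform
  distribution on n of them therefore has weights 1/n.\<close>

lemma escaping_sequence:
  assumes nc: "\<not> closed_above"
  obtains \<beta> :: "nat \<Rightarrow> real" and E :: "nat \<Rightarrow> real set"
  where "\<And>n. \<beta> n \<in> \<Gamma>\<^sub>0" "\<And>n. E n \<in> sets borel" "disjoint_family E"
    "\<And>n. 1 / 2 < measure (P (\<beta> n)) (E n)" "inj \<beta>"
proof -
  obtain B N where BN: "\<And>m. m \<in> upper_charged \<Longrightarrow>
    B m \<in> \<Gamma>\<^sub>0 \<and> N m \<in> upper_charged \<and> m \<le> N m \<and> 1 / 2 < measure (P (B m)) {m<..N m}"
    using escaping_step[OF nc] by metis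
  obtain m0 where m0: "m0 \<in> upper_charged" using upper_charged_nonempty by auto
  define m where "m n = (N ^^ n) m0" for n
  have m_in: "m n \<in> upper_charged" for n
  proof (induction n)
    case (Suc n)
    then show ?case using BN[of "m n"] by (simp add: m_def)
  qed (simp add: m_def m0)
  have m_Suc: "m (Suc n) = N (m n)" for n by (simp add: m_def)
  have m_mono: "incseq m"
    by (rule incseq_SucI) (use BN[OF m_in] in \<open>simp add: m_Suc\<close>)
  define \<beta> where "\<beta> n = B (m n)" for n
  define E where "E n = {m n<..m (Suc n)}" for n
  have less: "E i \<inter> E j = {}" if "i < j" for i j
  proof -
    have "m (Suc i) \<le> m j" using m_mono that by (auto simp: incseq_def)
    then show ?thesis by (auto simp: E_def)
  qed
  then have disj: "disjoint_family E"
    unfolding disjoint_family_on_def by (metis Int_commute linorder_neqE_nat)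
  have half: "1 / 2 < measure (P (\<beta> n)) (E n)" and \<beta>_in: "\<beta> n \<in> \<Gamma>\<^sub>0" for n
    using BN[OF m_in[of n]] by (auto simp: E_def \<beta>_def m_Suc)
  have "inj \<beta>"
  proof (rule injI, rule ccontr)
    fix i j assume eq: "\<beta> i = \<beta> j" and "i \<noteq> j"
    interpret P\<beta>: prob_space "P (\<beta> i)" by (rule prob_space_P[OF trunc_cases(1)[OF \<beta>_in]])
    have "measure (P (\<beta> i)) (E i \<union> E j) = measure (P (\<beta> i)) (E i) + measure (P (\<beta> i)) (E j)"
      using disj \<open>i \<noteq> j\<close> by (intro P\<beta>.finite_measure_Union) (auto simp: E_def disjoint_family_on_def)
    then show False
      using half[of i] half[of j] eq P\<beta>.prob_le_1[of "E i \<union> E j"] by simp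
  qed
  then show thesis using that[of \<beta> E] half \<beta>_in disj by (simp add: E_def)
qed

lemma sum_info_div_ge:
  assumes R: "R \<in> prob_measures" and \<beta>: "\<And>i::nat. \<beta> i \<in> \<Gamma>\<^sub>0"
    and E: "\<And>i. E i \<in> sets borel" "disjoint_family E" "\<And>i. 1 / 2 < measure (P (\<beta> i)) (E i)"
    and n: "0 < n"
  shows "ereal (ln (real n) / 2 - 1) \<le> (\<Sum>i<n. ereal (1 / real n) * info_div (P (\<beta> i)) R)"
proof -
  interpret R: prob_space R using R by (simp add: prob_measures_def)
  have sR: "sets R = sets borel" using R by (simp add: prob_measures_def)
  have le1: "(\<Sum>i<n. measure R (E i)) \<le> 1"
  proof -
    have "(\<Sum>i<n. measure R (E i)) = measure R (\<Union>i<n. E i)"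
      using E by (intro R.finite_measure_finite_Union[symmetric]) (auto simp: sR disjoint_family_on_def)
    then show ?thesis by simp
  qed
  have each: "ereal (ln (real n) / 2 - real n * measure R (E i)) \<le> info_div (P (\<beta> i)) R" for i
  proof -
    \<comment> \<open>As n \<ge> 1, the logarithm is nonnegative and the probability may be lowered
      to 1/2.\<close>
    have "ln (real n) * (1 / 2) \<le> ln (real n) * measure (P (\<beta> i)) (E i)"
      using n E(3)[of i] by (intro mult_left_mono) auto
    then have "ln (real n) / 2 - real n * measure R (E i)
        \<le> measure (P (\<beta> i)) (E i) * ln (real n) - real n * measure R (E i)"
      by (simp add: mult.commute)
    also have "ereal \<dots> \<le> info_div (P (\<beta> i)) R"
      using n by (intro info_div_event_ge P_in_prob_measures trunc_cases(1)[OF \<beta>] R E(1)) auto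
    finally show ?thesis by simp
  qed
  have "ln (real n) / 2 - 1 \<le> ln (real n) / 2 - (\<Sum>i<n. measure R (E i))"
    using le1 by simp
  also have "\<dots> = (\<Sum>i<n. 1 / real n * (ln (real n) / 2 - real n * measure R (E i)))"
    using n by (simp add: right_diff_distrib sum_subtractf)
  finally have "ereal (ln (real n) / 2 - 1) \<le> (\<Sum>i<n. ereal (1 / real n) * ereal (ln (real n) / 2 - real n * measure R (E i)))"
    by simp
  also have "\<dots> \<le> (\<Sum>i<n. ereal (1 / real n) * info_div (P (\<beta> i)) R)"
    by (intro sum_mono ereal_mult_left_mono each) auto
  finally show ?thesis .
qed

section \<open>Necessity of the finiteness condition\<close>

lemma ex_ln_half_greater: "\<exists>n>0. K < ln (real n) / 2 - 1"
proof -
  obtain n :: nat where n: "exp (2 * K + 2) < real n" using reals_Archimedean2 by blast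
  moreover have "0 < exp (2 * K + 2)" by simp
  ultimately have "0 < real n" by linarith
  then have "ln (exp (2 * K + 2)) < ln (real n)" using n by (intro ln_less_cancel_iff[THEN iffD2]) auto
  then show ?thesis using \<open>0 < real n\<close> by (intro exI[of _ n]) auto
qed

lemma dominated_imp_closed_above:
  assumes R: "R \<in> prob_measures" and fin: "(SUP \<beta>\<in>\<Gamma>\<^sub>0. info_div (P \<beta>) R) < \<infinity>"
  shows closed_above
proof (rule ccontr)
  assume "\<not> closed_above"
  then obtain \<beta> E where \<beta>E: "\<And>n::nat. \<beta> n \<in> \<Gamma>\<^sub>0" "\<And>n. E n \<in> sets borel" "disjoint_family E"
    "\<And>n. 1 / 2 < measure (P (\<beta> n)) (E n)" "inj \<beta>"
    using escaping_sequence by blast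
  let ?K = "SUP \<beta>\<in>\<Gamma>\<^sub>0. info_div (P \<beta>) R"
  have "0 \<le> info_div (P b) R" using R b_in by (intro info_div_nonneg P_in_prob_measures)
  also have "\<dots> \<le> ?K" using b_in by (intro SUP_upper)
  finally obtain K where K: "?K = ereal K" using fin by (cases ?K) auto
  obtain n where n: "0 < n" "K < ln (real n) / 2 - 1" using ex_ln_half_greater by blast
  have "ereal (ln (real n) / 2 - 1) \<le> (\<Sum>i<n. ereal (1 / real n) * info_div (P (\<beta> i)) R)"
    by (rule sum_info_div_ge[OF R \<beta>E(1-4) n(1)])
  also have "\<dots> \<le> (\<Sum>i<n. ereal (1 / real n) * ereal K)"
    unfolding K[symmetric] using \<beta>E(1) by (intro sum_mono ereal_mult_left_mono SUP_upper) auto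
  also have "\<dots> = ereal K" using n(1) by simp
  finally show False using n(2) by simp
qed

lemma capacity_finite_imp_closed_above:
  assumes fin: "capacity Q b < \<infinity>"
  shows closed_above
proof (rule ccontr)
  assume "\<not> closed_above"
  then obtain \<beta> E where \<beta>E: "\<And>n::nat. \<beta> n \<in> \<Gamma>\<^sub>0" "\<And>n. E n \<in> sets borel" "disjoint_family E"
    "\<And>n. 1 / 2 < measure (P (\<beta> n)) (E n)" "inj \<beta>"
    using escaping_sequence by blast
  have ge: "ereal (ln (real n) / 2 - 1) \<le> capacity Q b" if n: "0 < n" for n
  proof -
    let ?B = "\<beta> ` {..<n}"
    define w where "w = pmf_of_set ?B"
    have inj: "inj_on \<beta> {..<n}" using \<beta>E(5) by (rule inj_on_subset) simp
    then have B: "finite ?B" "?B \<noteq> {}" "card ?B = n"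
      using n by (auto simp: card_image)
    have w: "set_pmf w = ?B" "\<And>i. i < n \<Longrightarrow> pmf w (\<beta> i) = 1 / real n"
      using B by (auto simp: w_def)
    have sub: "set_pmf w \<subseteq> \<Gamma>\<^sub>0" using \<beta>E(1) by (auto simp: w)
    then have R: "measure_pmf w \<bind> P \<in> prob_measures"
      by (intro mixture_in_prob_measures) (auto dest: trunc_cases(1))
    have "ereal (ln (real n) / 2 - 1) \<le> (\<Sum>i<n. ereal (1 / real n) * info_div (P (\<beta> i)) (measure_pmf w \<bind> P))"
      by (rule sum_info_div_ge[OF R \<beta>E(1-4) n])
    also have "\<dots> = mutual_info Q w"
      unfolding mutual_info_def w(1) using inj w(2) by (simp add: sum.reindex)
    also have "\<dots> \<le> capacity Q b"
      unfolding capacity_def using sub B(1) w(1) by (intro SUP_upper) auto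
    finally show ?thesis .
  qed
  show False
  proof (cases "capacity Q b")
    case (real K)
    obtain n where "0 < n" "K < ln (real n) / 2 - 1" using ex_ln_half_greater by blast
    then show False using ge[of n] real by simp
  qed (use fin ge[of 1] in auto)
qed

lemma not_finite_limitI:
  fixes f :: "real \<Rightarrow> ereal"
  assumes "\<And>K. \<forall>\<^sub>F x in F. ereal K < f x" "F \<noteq> bot"
  shows "\<not> finite_limit f F"
proof
  assume "finite_limit f F"
  then obtain L where L: "(f \<longlongrightarrow> L) F" "L < \<infinity>" by (auto simp: finite_limit_def)
  obtain K where K: "L < ereal K" using L(2) by (metis less_PInf_Ex_of_nat ereal_dense2)
  have "\<forall>\<^sub>F x in F. f x < ereal K" using L(1) K by (rule order_tendstoD(2))
  with assms(1)[of K] have "\<forall>\<^sub>F x in F. False" by eventually_elim auto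
  then show False using assms(2) by simp
qed

lemma ex_half_ln_greater: "\<exists>c\<ge>1. K < ln c / 2 - (1::real)"
proof -
  obtain n where "0 < n" "K < ln (real n) / 2 - 1" using ex_ln_half_greater by blast
  then show ?thesis by (intro exI[of _ "real n"]) auto
qed

text \<open>A point m is fixed beyond which the given member has little mass; near the upper end
  P_\<beta> has little mass up to m. The event inequality on \<open>{..m}\<close> makes one
  direction of the divergence large, on \<open>{m<..}\<close> the other.\<close>

lemma finite_limit_imp_closed_above:
  assumes \<beta>\<^sub>0: "\<beta>\<^sub>0 \<in> \<Gamma>\<^sub>0"
    and lim: "finite_limit (\<lambda>\<beta>. fam_div Q \<beta>\<^sub>0 \<beta>) (up_to (beta_sup Q)) \<or>
      finite_limit (\<lambda>\<beta>. fam_div Q \<beta> \<beta>\<^sub>0) (up_to (beta_sup Q))"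
  shows closed_above
proof (rule ccontr)
  assume nc: "\<not> closed_above"
  let ?F = "up_to (beta_sup Q)"
  have bot: "?F \<noteq> bot" by (simp add: up_to_def)
  interpret P0: prob_space "P \<beta>\<^sub>0" by (rule prob_space_P[OF trunc_cases(1)[OF \<beta>\<^sub>0]])
  have compl: "measure (P \<beta>) {m<..} = 1 - measure (P \<beta>) {..m}" if "\<beta> \<in> \<Gamma>\<^sub>0" for \<beta> m
  proof -
    interpret P: prob_space "P \<beta>" by (rule prob_space_P[OF trunc_cases(1)[OF that]])
    have "UNIV - {..m} = {m<..}" by auto
    then show ?thesis using P.prob_compl[of "{..m}"] by simp
  qed
  have both: "\<forall>\<^sub>F \<beta> in ?F. ereal K < fam_div Q \<beta>\<^sub>0 \<beta> \<and> ereal K < fam_div Q \<beta> \<beta>\<^sub>0" for K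
  proof -
    obtain c where c: "1 \<le> c" "K < ln c / 2 - 1" using ex_half_ln_greater by blast
    \<comment> \<open>The bound 1/c keeps the penalty c q below 1, and 1/2 leaves at least half of
      the mass on the complementary half line.\<close>
    define \<epsilon> where "\<epsilon> = min (1 / c) (1 / 2)"
    have \<epsilon>: "0 < \<epsilon>" "c * \<epsilon> \<le> 1" "\<epsilon> \<le> 1 / 2" using c by (auto simp: \<epsilon>_def min_def field_simps)
    obtain m where m: "m \<in> upper_charged" "measure (P \<beta>\<^sub>0) {m<..} < \<epsilon>"
      using upper_part_small[OF nc \<beta>\<^sub>0 \<epsilon>(1)] by auto
    have bound: "K < p * ln c - c * q" if "1 / 2 \<le> p" "q \<le> \<epsilon>" for p q
    proof -
      have "1 / 2 * ln c \<le> p * ln c" using that c by (intro mult_right_mono) auto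
      moreover have "c * q \<le> c * \<epsilon>" using that c by (intro mult_left_mono) auto
      ultimately show ?thesis using c \<epsilon>(2) by linarith
    qed
    from lower_part_vanishes[OF nc m(1) \<epsilon>(1)] eventually_trunc show ?thesis
    proof eventually_elim
      case (elim \<beta>)
      have in_pm: "P \<beta> \<in> prob_measures" "P \<beta>\<^sub>0 \<in> prob_measures"
        using elim(2) \<beta>\<^sub>0 by (auto intro: P_in_prob_measures trunc_cases(1))
      have "K < measure (P \<beta>\<^sub>0) {..m} * ln c - c * measure (P \<beta>) {..m}"
        using elim m(2) \<epsilon>(3) compl[OF \<beta>\<^sub>0, of m] by (intro bound) auto
      then have "ereal K < ereal (measure (P \<beta>\<^sub>0) {..m} * ln c - c * measure (P \<beta>) {..m})" by simp
      also have "\<dots> \<le> fam_div Q \<beta>\<^sub>0 \<beta>"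
        unfolding fam_div_def using c(1) by (intro info_div_event_ge in_pm) auto
      finally have 1: "ereal K < fam_div Q \<beta>\<^sub>0 \<beta>" .
      have "K < measure (P \<beta>) {m<..} * ln c - c * measure (P \<beta>\<^sub>0) {m<..}"
        using elim m(2) \<epsilon>(3) compl[OF elim(2), of m] by (intro bound) auto
      then have "ereal K < ereal (measure (P \<beta>) {m<..} * ln c - c * measure (P \<beta>\<^sub>0) {m<..})" by simp
      also have "\<dots> \<le> fam_div Q \<beta> \<beta>\<^sub>0"
        unfolding fam_div_def using c(1) by (intro info_div_event_ge in_pm) auto
      finally have 2: "ereal K < fam_div Q \<beta> \<beta>\<^sub>0" .
      from 1 2 show ?case by simp
    qed
  qed
  have "\<not> finite_limit (\<lambda>\<beta>. fam_div Q \<beta>\<^sub>0 \<beta>) ?F"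
    using both bot by (intro not_finite_limitI) (auto simp: eventually_conj_iff)
  moreover have "\<not> finite_limit (\<lambda>\<beta>. fam_div Q \<beta> \<beta>\<^sub>0) ?F"
    using both bot by (intro not_finite_limitI) (auto simp: eventually_conj_iff)
  ultimately show False using lim by simp
qed

end

theorem theorem1:
  fixes Q :: "real measure" and b :: real
  assumes "sets Q = sets borel"
    and "sigma_finite_measure Q"
    and "emeasure Q UNIV \<noteq> 0"
    and "beta_inf Q < ereal b"
    and "ereal b < beta_sup Q"
  shows
    "((shtarkov Q b < \<infinity>) \<longleftrightarrow>
        \<bar>minimax_regret Q b\<bar> \<noteq> \<infinity>) \<and>
     ((shtarkov Q b < \<infinity>) \<longleftrightarrow>
        \<bar>minimax_redundancy Q b\<bar> \<noteq> \<infinity>) \<and>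
     ((shtarkov Q b < \<infinity>) \<longleftrightarrow>
        (\<exists>Qdom\<in>prob_measures.
          (SUP \<beta>\<in>left_trunc_params Q b. info_div (exp_family Q \<beta>) Qdom) < \<infinity>)) \<and>
     ((shtarkov Q b < \<infinity>) \<longleftrightarrow>
        (\<exists>\<beta>'\<in>left_trunc_params Q b.
          (SUP \<beta>\<in>left_trunc_params Q b. fam_div Q \<beta> \<beta>') < \<infinity>)) \<and>
     ((shtarkov Q b < \<infinity>) \<longleftrightarrow>
        \<bar>capacity Q b\<bar> \<noteq> \<infinity>) \<and>
     ((shtarkov Q b < \<infinity>) \<longleftrightarrow>
        (\<exists>\<beta>\<^sub>0\<in>left_trunc_params Q b.
          finite_limit (\<lambda>\<beta>. fam_div Q \<beta>\<^sub>0 \<beta>) (up_to (beta_sup Q)) \<or>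
          finite_limit (\<lambda>\<beta>. fam_div Q \<beta> \<beta>\<^sub>0) (up_to (beta_sup Q))))"
proof -
  interpret left_truncated Q b
    by (intro left_truncated.intro exp_generator.intro left_truncated_axioms.intro assms)
  let ?dominated = "\<exists>R\<in>prob_measures. (SUP \<beta>\<in>\<Gamma>\<^sub>0. info_div (P \<beta>) R) < \<infinity>"
  have redundancy: "\<bar>minimax_redundancy Q b\<bar> \<noteq> \<infinity> \<longleftrightarrow> ?dominated"
    unfolding minimax_redundancy_finite_iff[symmetric]
    using minimax_redundancy_nonneg by (cases "minimax_redundancy Q b") auto
  \<comment> \<open>The regret is at least the redundancy, which is nonnegative, so minus infinity
    cannot occur.\<close>
  have regret: "\<bar>minimax_regret Q b\<bar> \<noteq> \<infinity> \<longleftrightarrow> minimax_regret Q b < \<infinity>"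
    using order_trans[OF minimax_redundancy_nonneg minimax_redundancy_le_regret]
    by (cases "minimax_regret Q b") auto
  have dominated: "?dominated \<Longrightarrow> closed_above"
    by (elim bexE) (rule dominated_imp_closed_above)
  have regret_dominated: "minimax_regret Q b < \<infinity> \<Longrightarrow> ?dominated"
    unfolding minimax_redundancy_finite_iff[symmetric]
    by (rule le_less_trans[OF minimax_redundancy_le_regret])
  \<comment> \<open>A finite Shtarkov integral reaches \<open>closed_above\<close> by way of finite
    regret and finite redundancy.\<close>
  have closed: "shtarkov Q b < \<infinity> \<longleftrightarrow> closed_above"
    by (rule iffI) (erule dominated[OF regret_dominated[OF shtarkov_finite_imp_regret_finite]],
      erule closed_above_imp_shtarkov_finite)
  have closed_regret: "minimax_regret Q b < \<infinity> \<longleftrightarrow> closed_above"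
    by (rule iffI) (erule dominated[OF regret_dominated],
      erule shtarkov_finite_imp_regret_finite[OF closed_above_imp_shtarkov_finite])
  have closed_dominated: "?dominated \<longleftrightarrow> closed_above"
    by (rule iffI) (erule dominated,
      erule regret_dominated[OF shtarkov_finite_imp_regret_finite[OF closed_above_imp_shtarkov_finite]])
  have capacity: "\<bar>capacity Q b\<bar> \<noteq> \<infinity> \<longleftrightarrow> closed_above"
    using shtarkov_finite_imp_capacity_finite capacity_finite_imp_closed_above closed
    by (cases "capacity Q b") auto
  have member: "(\<exists>\<beta>'\<in>\<Gamma>\<^sub>0. (SUP \<beta>\<in>\<Gamma>\<^sub>0. fam_div Q \<beta> \<beta>') < \<infinity>) \<longleftrightarrow> closed_above"
  proof
    assume "\<exists>\<beta>'\<in>\<Gamma>\<^sub>0. (SUP \<beta>\<in>\<Gamma>\<^sub>0. fam_div Q \<beta> \<beta>') < \<infinity>"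
    then show closed_above
      unfolding fam_div_def
      by (elim bexE) (rule dominated_imp_closed_above[OF P_in_prob_measures[OF trunc_cases(1)]])
  qed (rule closed_above_imp_member_dominates)
  have limit: "(\<exists>\<beta>\<^sub>0\<in>\<Gamma>\<^sub>0.
      finite_limit (\<lambda>\<beta>. fam_div Q \<beta>\<^sub>0 \<beta>) (up_to (beta_sup Q)) \<or>
      finite_limit (\<lambda>\<beta>. fam_div Q \<beta> \<beta>\<^sub>0) (up_to (beta_sup Q))) \<longleftrightarrow> closed_above"
    by (rule iffI) (erule bexE, erule finite_limit_imp_closed_above, assumption,
      rule bexI[of _ b], erule closed_above_imp_finite_limit, rule b_in(2))
  show ?thesis
    unfolding redundancy regret closed closed_regret closed_dominated capacity member limit by simp
qed

end
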